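(* Let $\mathfrak{G}$ be an étale groupoid whose unit space is homeomorphic to the Cantor set, and suppose that every $\mathfrak{G}$-orbit has at least $3$ elements. For a bisection $F\subset\mathfrak{G}$ with $\mathsf{s}(F)\cap\mathsf{r}(F)=\emptyset$ put $\tau_F=F\cup F^{-1}\cup\bigl(\mathfrak{G}^{(0)}\setminus(\mathsf{s}(F)\cup\mathsf{r}(F))\bigr)\in\mathsf{S}(\mathfrak{G})$, and let $1_{\mathsf{s}(F)}$ also denote the class in $H_0(\mathfrak{G},\mathbb{Z}/2\mathbb{Z})$ of the indicator function of $\mathsf{s}(F)$. Then the correspondence $1_{\mathsf{s}(F)}\mapsto\tau_F$ (for all bisections $F$ with $\mathsf{s}(F)\cap\mathsf{r}(F)=\emptyset$) induces a well-defined epimorphism from $H_0(\mathfrak{G},\mathbb{Z}/2\mathbb{Z})$ to $\mathsf{S}(\mathfrak{G})/\mathsf{A}(\mathfrak{G})$.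
   Context: A groupoid $\mathfrak{G}$ is a small category in which every morphism is invertible, identified with its set of morphisms; $\mathsf{s}(\gamma)=\gamma^{-1}\gamma$ and $\mathsf{r}(\gamma)=\gamma\gamma^{-1}$ are the source and range, $\gamma_1\gamma_2$ is defined iff $\mathsf{s}(\gamma_1)=\mathsf{r}(\gamma_2)$, and $\mathfrak{G}^{(0)}$ is the set of units (elements $\gamma\gamma^{-1}$). A topological groupoid is a groupoid with a topology for which multiplication and inversion are continuous (not assumed Hausdorff). A bisection is a compact open subset $F\subset\mathfrak{G}$ such that $\mathsf{s}:F\to\mathsf{s}(F)$ and $\mathsf{r}:F\to\mathsf{r}(F)$ are homeomorphisms onto open subsets of $\mathfrak{G}^{(0)}$. $\mathfrak{G}$ is étale if bisections form a basis of its topology. Throughout, groupoids are étale and $\mathfrak{G}^{(0)}$ is homeomorphic to the Cantor set. Subsets are multiplied by $AB=\{ab: a\in A, b\in B, ab \text{ defined}\}$, and $A^{-1}=\{a^{-1}:a\in A\}$. The $\mathfrak{G}$-orbit of a unit $x$ is $\{\mathsf{r}(\gamma):\mathsf{s}(\gamma)=x\}$. The topological full group $\mathsf{F}(\mathfrak{G})$ is the group, under multiplication of subsets, of all bisections $F$ with $\mathsf{s}(F)=\mathsf{r}(F)=\mathfrak{G}^{(0)}$. A multisection of degree $d$ is a collection $\mathcal{F}=\{F_{i,j}\}_{i,j=1}^d$ of $d^2$ bisections such that $F_{i_2,i_3}F_{i_1,i_2}=F_{i_1,i_3}$ for all $i_1,i_2,i_3$ and the $F_{i,i}$ are pairwise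 disjoint subsets of $\mathfrak{G}^{(0)}$. Its domain is $U=\bigcup_i F_{i,i}$. For a permutation $\pi$ of $\{1,\dots,d\}$ put $\mathcal{F}_\pi=\bigcup_{i=1}^d F_{i,\pi(i)}\cup(\mathfrak{G}^{(0)}\setminus U)\in\mathsf{F}(\mathfrak{G})$; let $\mathsf{S}(\mathcal{F})$ be the group of all $\mathcal{F}_\pi$ and $\mathsf{A}(\mathcal{F})$ the subgroup of those with $\pi$ even. $\mathsf{S}(\mathfrak{G})$ is the subgroup of $\mathsf{F}(\mathfrak{G})$ generated by all $\mathsf{S}(\mathcal{F})$ for multisections $\mathcal{F}$ of degree $2$, and $\mathsf{A}(\mathfrak{G})\le\mathsf{S}(\mathfrak{G})$ is the subgroup generated by all $\mathsf{A}(\mathcal{F})$ for multisections $\mathcal{F}$ of degree $3$; both are normal in $\mathsf{F}(\mathfrak{G})$. For an abelian group $A$, $C_c(\mathfrak{G},A)$ (resp. $C_c(\mathfrak{G}^{(0)},A)$) is the subgroup of the group of all functions $\mathfrak{G}\to A$ (resp. $\mathfrak{G}^{(0)}\to A$) generated by the functions equal to a constant $a\in A$ on a compact open set and $0$ elsewhere. Define $\delta_1:C_c(\mathfrak{G},A)\to C_c(\mathfrak{G}^{(0)},A)$ by $\delta_1(f)(x)=\sum_{\mathsf{s}(\gamma)=x}f(\gamma)-\sum_{\mathsf{r}(\gamma)=x}f(\gamma)$. Then $H_0(\mathfrak{G},A)=C_c(\mathfrak{G}^{(0)},A)/\operatorname{Im}\delta_1$. *)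

theory Defs
  imports "HOL-Analysis.Analysis" "HOL-Algebra.Generated_Groups" "HOL-Library.Z2"
    "HOL-Combinatorics.Permutations"
begin

section \<open>Topological groupoids\<close>

text \<open>
  A groupoid is identified with its set of morphisms, which is the underlying set of the topology
  \<open>gtop\<close>. The composition \<open>gcomp\<close> is a total HOL function, but its values are meaningful only on
  composable pairs.
\<close>

record 'g top_groupoid =
  gtop :: "'g topology"
  gcomp :: "'g \<Rightarrow> 'g \<Rightarrow> 'g"
  ginv :: "'g \<Rightarrow> 'g"

definition arrows :: "'g top_groupoid \<Rightarrow> 'g set" where
  "arrows G = topspace (gtop G)"

definition src :: "'g top_groupoid \<Rightarrow> 'g \<Rightarrow> 'g" where
  "src G x = gcomp G (ginv G x) x"

definition rng :: "'g top_groupoid \<Rightarrow> 'g \<Rightarrow> 'g" where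
  "rng G x = gcomp G x (ginv G x)"

definition units :: "'g top_groupoid \<Rightarrow> 'g set" where
  "units G = rng G ` arrows G"

definition composable :: "'g top_groupoid \<Rightarrow> ('g \<times> 'g) set" where
  "composable G = {(x, y). x \<in> arrows G \<and> y \<in> arrows G \<and> src G x = rng G y}"

definition unit_space :: "'g top_groupoid \<Rightarrow> 'g topology" where
  "unit_space G = subtopology (gtop G) (units G)"

definition groupoid_orbit :: "'g top_groupoid \<Rightarrow> 'g \<Rightarrow> 'g set" where
  "groupoid_orbit G x = {rng G y | y. y \<in> arrows G \<and> src G y = x}"

text \<open>
  The axioms say that the arrows are the morphisms of a small category whose objects are the units
  (identified with the identity morphisms) and in which \<open>ginv G x\<close> is the inverse of \<open>x\<close>.
\<close>

locale groupoid =
  fixes G :: "'g top_groupoid"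
  assumes inv_closed: "x \<in> arrows G \<Longrightarrow> ginv G x \<in> arrows G"
    and src_inv: "x \<in> arrows G \<Longrightarrow> src G (ginv G x) = rng G x"
    and rng_inv: "x \<in> arrows G \<Longrightarrow> rng G (ginv G x) = src G x"
    and comp_closed: "(x, y) \<in> composable G \<Longrightarrow> gcomp G x y \<in> arrows G"
    and src_comp: "(x, y) \<in> composable G \<Longrightarrow> src G (gcomp G x y) = src G y"
    and rng_comp: "(x, y) \<in> composable G \<Longrightarrow> rng G (gcomp G x y) = rng G x"
    and comp_assoc: "(x, y) \<in> composable G \<Longrightarrow> (y, z) \<in> composable G \<Longrightarrow>
           gcomp G (gcomp G x y) z = gcomp G x (gcomp G y z)"
    and comp_src: "x \<in> arrows G \<Longrightarrow> gcomp G x (src G x) = x"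
    and rng_comp_left: "x \<in> arrows G \<Longrightarrow> gcomp G (rng G x) x = x"

locale topological_groupoid = groupoid +
  assumes continuous_comp:
      "continuous_map (subtopology (prod_topology (gtop G) (gtop G)) (composable G)) (gtop G)
         (\<lambda>(x, y). gcomp G x y)"
    and continuous_inv: "continuous_map (gtop G) (gtop G) (ginv G)"

text \<open>
  Groupoids need not be Hausdorff. Following the usual convention in that setting, a compact subset
  is one that is quasi-compact and Hausdorff in the subspace topology. For bisections and for
  subsets of the (Hausdorff) unit space the second condition is automatic. It matters only for
  the group of functions \<open>C_c (gtop G)\<close> below: if arbitrary quasi-compact open sets \<open>U\<close> were
  admitted, then \<open>delta1\<close> of the indicator of \<open>U\<close> (for instance when \<open>U\<close> is the union of two
  bisections with non-compact intersection) need not belong to \<open>C_c (unit_space G)\<close>.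
\<close>

definition compact_open :: "'x topology \<Rightarrow> 'x set \<Rightarrow> bool" where
  "compact_open X U \<longleftrightarrow>
     openin X U \<and> compactin X U \<and> Hausdorff_space (subtopology X U)"

definition bisection :: "'g top_groupoid \<Rightarrow> 'g set \<Rightarrow> bool" where
  "bisection G F \<longleftrightarrow> compact_open (gtop G) F \<and>
     openin (unit_space G) (src G ` F) \<and>
     openin (unit_space G) (rng G ` F) \<and>
     homeomorphic_map (subtopology (gtop G) F) (subtopology (unit_space G) (src G ` F)) (src G) \<and>
     homeomorphic_map (subtopology (gtop G) F) (subtopology (unit_space G) (rng G ` F)) (rng G)"

text \<open>Bisections are open, so being a basis amounts to the following.\<close>

locale etale_groupoid = topological_groupoid +
  assumes bisection_basis:
    "openin (gtop G) U \<Longrightarrow> x \<in> U \<Longrightarrow> \<exists>F. bisection G F \<and> x \<in> F \<and> F \<subseteq> U"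

definition cantor_space :: "(nat \<Rightarrow> bool) topology" where
  "cantor_space = product_topology (\<lambda>_. discrete_topology UNIV) UNIV"

section \<open>Topological full group and its subgroups\<close>

definition setcomp :: "'g top_groupoid \<Rightarrow> 'g set \<Rightarrow> 'g set \<Rightarrow> 'g set" where
  "setcomp G A B = {gcomp G a b | a b. a \<in> A \<and> b \<in> B \<and> (a, b) \<in> composable G}"

definition full_group :: "'g top_groupoid \<Rightarrow> 'g set monoid" where
  "full_group G =
     \<lparr>carrier = {F. bisection G F \<and> src G ` F = units G \<and> rng G ` F = units G},
      monoid.mult = setcomp G, one = units G\<rparr>"

definition multisection :: "'g top_groupoid \<Rightarrow> nat \<Rightarrow> (nat \<Rightarrow> nat \<Rightarrow> 'g set) \<Rightarrow> bool" where
  "multisection G d F \<longleftrightarrow>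
     (\<forall>i\<in>{1..d}. \<forall>j\<in>{1..d}. bisection G (F i j)) \<and>
     (\<forall>i\<in>{1..d}. \<forall>j\<in>{1..d}. \<forall>k\<in>{1..d}. setcomp G (F j k) (F i j) = F i k) \<and>
     (\<forall>i\<in>{1..d}. F i i \<subseteq> units G) \<and>
     (\<forall>i\<in>{1..d}. \<forall>j\<in>{1..d}. i \<noteq> j \<longrightarrow> F i i \<inter> F j j = {})"

definition multisection_perm ::
  "'g top_groupoid \<Rightarrow> nat \<Rightarrow> (nat \<Rightarrow> nat \<Rightarrow> 'g set) \<Rightarrow> (nat \<Rightarrow> nat) \<Rightarrow> 'g set" where
  "multisection_perm G d F p = (\<Union>i\<in>{1..d}. F i (p i)) \<union> (units G - (\<Union>i\<in>{1..d}. F i i))"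

definition S_multisection :: "'g top_groupoid \<Rightarrow> nat \<Rightarrow> (nat \<Rightarrow> nat \<Rightarrow> 'g set) \<Rightarrow> 'g set set" where
  "S_multisection G d F = {multisection_perm G d F p | p. p permutes {1..d}}"

definition A_multisection :: "'g top_groupoid \<Rightarrow> nat \<Rightarrow> (nat \<Rightarrow> nat \<Rightarrow> 'g set) \<Rightarrow> 'g set set" where
  "A_multisection G d F = {multisection_perm G d F p | p. p permutes {1..d} \<and> evenperm p}"

definition S_group :: "'g top_groupoid \<Rightarrow> 'g set monoid" where
  "S_group G = subgroup_generated (full_group G)
     (\<Union>{S_multisection G 2 F | F. multisection G 2 F})"

definition A_group :: "'g top_groupoid \<Rightarrow> 'g set monoid" where
  "A_group G = subgroup_generated (full_group G)
     (\<Union>{A_multisection G 3 F | F. multisection G 3 F})"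

definition tau :: "'g top_groupoid \<Rightarrow> 'g set \<Rightarrow> 'g set" where
  "tau G F = F \<union> ginv G ` F \<union> (units G - (src G ` F \<union> rng G ` F))"

section \<open>Homology in degree zero\<close>

text \<open>
  Functions on a space are represented by HOL functions that vanish outside the underlying set of
  that space. The coefficient group is given by a type of class \<open>ab_group_add\<close>; the integers
  modulo 2 are the type \<open>bit\<close>.
\<close>

definition function_group :: "'x topology \<Rightarrow> ('x \<Rightarrow> 'a::ab_group_add) monoid" where
  "function_group X =
     \<lparr>carrier = {f. \<forall>x. x \<notin> topspace X \<longrightarrow> f x = 0},
      monoid.mult = (\<lambda>f g x. f x + g x), one = (\<lambda>_. 0)\<rparr>"

definition C_c :: "'x topology \<Rightarrow> ('x \<Rightarrow> 'a::ab_group_add) monoid" where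
  "C_c X = subgroup_generated (function_group X)
     {(\<lambda>x. if x \<in> U then a else 0) | U a. compact_open X U}"

text \<open>
  For \<open>f\<close> in \<open>C_c (gtop G)\<close> the sums have only finitely many nonzero terms, but the fibres of the
  source and range maps may be infinite, hence the restriction to the support.
\<close>

definition delta1 :: "'g top_groupoid \<Rightarrow> ('g \<Rightarrow> 'a::ab_group_add) \<Rightarrow> 'g \<Rightarrow> 'a" where
  "delta1 G f = (\<lambda>x. if x \<in> units G
     then (\<Sum>y | y \<in> arrows G \<and> src G y = x \<and> f y \<noteq> 0. f y)
        - (\<Sum>y | y \<in> arrows G \<and> rng G y = x \<and> f y \<noteq> 0. f y)
     else 0)"

definition boundaries :: "'g top_groupoid \<Rightarrow> ('g \<Rightarrow> 'a::ab_group_add) set" where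
  "boundaries G = delta1 G ` carrier (C_c (gtop G))"

definition H0 :: "'g top_groupoid \<Rightarrow> ('g \<Rightarrow> 'a::ab_group_add) set monoid" where
  "H0 G = C_c (unit_space G) Mod boundaries G"

definition H0_class :: "'g top_groupoid \<Rightarrow> ('g \<Rightarrow> 'a::ab_group_add) \<Rightarrow> ('g \<Rightarrow> 'a) set" where
  "H0_class G f = boundaries G #>\<^bsub>C_c (unit_space G)\<^esub> f"

section \<open>The correspondence\<close>

definition induced_by_tau :: "'g top_groupoid \<Rightarrow> (('g \<Rightarrow> bit) set \<Rightarrow> 'g set set) \<Rightarrow> bool" where
  "induced_by_tau G h \<longleftrightarrow>
     (\<forall>F. bisection G F \<and> src G ` F \<inter> rng G ` F = {} \<longrightarrow>
        h (H0_class G (indicator (src G ` F))) = carrier (A_group G) #>\<^bsub>S_group G\<^esub> tau G F)"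

end

theory Submission
  imports Defs
begin

text \<open>
  Write \<open>[F]\<close> for the class of \<open>tau G F\<close> modulo the alternating group. If two bisections share
  their source and have disjoint ranges, the product of the two involutions is a 3-cycle, so their
  classes agree. As every orbit has at least three points, any two local bisections can be compared
  through a third one leading to yet another point, and by compactness \<open>[F]\<close> depends only on the
  source of \<open>F\<close>; more generally it is unchanged when the source is transported by a bisection.
  Hence the quotient is abelian of exponent 2, and \<open>F \<mapsto> [F]\<close> extends to a finitely additive
  function on compact open sets of units that is invariant under bisections. With coefficients
  modulo 2 such functions are the same as homomorphisms on \<open>H0 G\<close>.
\<close>

section \<open>Algebra in a groupoid\<close>

text \<open>The three orbit points are the two ends of an arrow and one more point to escape to.
  Displacing bisections F and H through x may also send x to the same point, and there no 3-cycle is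
  available directly. A third bisection K through x, whose range avoids both x and that common
  point, can be compared with each of them. Since tau_F = tau_{F^{-1}}, the class is determined by
  the range as well, and alternating the two comparisons along K and K B^{-1} gives invariance under
  B. Commutativity follows, because conjugating tau_F by g moves the source of F by a bisection
  contained in g.

  Two obstacles shape the rest. A prescribed compact open set of units need not be the source of a
  displacing bisection (the whole nonempty unit space never is), so the additive function must be
  glued from local pieces. And arrows need not form a Hausdorff space, so two bisections may have a
  non-compact intersection. Intersections and differences are therefore taken inside a fixed
  Hausdorff compact open set, mostly the unit space, and bisections are cut down by their
  sources.\<close>

context groupoid begin

lemma
  assumes "x \<in> arrows G" "y \<in> arrows G" "src G x = rng G y"
  shows comp_in_arrows: "gcomp G x y \<in> arrows G"
    and src_of_comp: "src G (gcomp G x y) = src G y"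
    and rng_of_comp: "rng G (gcomp G x y) = rng G x"
  using assms comp_closed src_comp rng_comp by (auto simp: composable_def)

lemma gcomp_assoc:
  assumes "x \<in> arrows G" "y \<in> arrows G" "z \<in> arrows G" "src G x = rng G y" "src G y = rng G z"
  shows "gcomp G (gcomp G x y) z = gcomp G x (gcomp G y z)"
  using assms comp_assoc by (auto simp: composable_def)

lemma gcomp_inv: "gcomp G x (ginv G x) = rng G x"
  and gcomp_inv_left: "gcomp G (ginv G x) x = src G x"
  by (simp_all add: src_def rng_def)

lemmas groupoid_simps = inv_closed src_inv rng_inv comp_in_arrows src_of_comp rng_of_comp
  comp_src rng_comp_left gcomp_inv gcomp_inv_left

lemma
  assumes "x \<in> arrows G"
  shows rng_in_arrows: "rng G x \<in> arrows G"
    and src_in_arrows: "src G x \<in> arrows G"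
    and src_rng: "src G (rng G x) = rng G x"
    and rng_rng: "rng G (rng G x) = rng G x"
    and src_src: "src G (src G x) = src G x"
    and rng_src: "rng G (src G x) = src G x"
proof -
  show "rng G x \<in> arrows G" "src G x \<in> arrows G"
    by (metis gcomp_inv gcomp_inv_left inv_closed src_inv rng_inv comp_in_arrows assms)+
  show "src G (rng G x) = rng G x" "rng G (rng G x) = rng G x"
    using assms by (metis gcomp_inv inv_closed rng_inv src_inv src_of_comp rng_of_comp)+
  show "src G (src G x) = src G x" "rng G (src G x) = src G x"
    using assms by (metis gcomp_inv_left inv_closed rng_inv src_inv src_of_comp rng_of_comp)+
qed

lemma inv_inv:
  assumes "x \<in> arrows G"
  shows "ginv G (ginv G x) = x"
proof -
  let ?y = "ginv G (ginv G x)"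
  have "?y = gcomp G ?y (gcomp G (ginv G x) x)"
    using assms by (metis comp_src gcomp_inv_left inv_closed src_inv rng_inv)
  also have "\<dots> = gcomp G (gcomp G ?y (ginv G x)) x"
    using assms by (intro gcomp_assoc [symmetric]) (simp_all add: groupoid_simps)
  also have "\<dots> = x"
    using assms by (simp add: gcomp_inv_left src_inv rng_comp_left)
  finally show ?thesis .
qed

lemma units_subset_arrows: "units G \<subseteq> arrows G"
  by (auto simp: units_def rng_in_arrows)

lemma unit_in_arrows: "u \<in> units G \<Longrightarrow> u \<in> arrows G"
  using units_subset_arrows by blast

lemma src_unit: "u \<in> units G \<Longrightarrow> src G u = u"
  and rng_unit: "u \<in> units G \<Longrightarrow> rng G u = u"
  by (auto simp: units_def src_rng rng_rng)

lemma rng_in_units: "x \<in> arrows G \<Longrightarrow> rng G x \<in> units G"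
  by (simp add: units_def)

lemma src_in_units: "x \<in> arrows G \<Longrightarrow> src G x \<in> units G"
  by (metis rng_in_units rng_inv inv_closed)

lemma inv_unit:
  assumes "u \<in> units G"
  shows "ginv G u = u"
  by (metis assms comp_src gcomp_inv_left inv_closed src_inv rng_unit src_unit unit_in_arrows)

lemma comp_unit_right: "x \<in> arrows G \<Longrightarrow> u \<in> units G \<Longrightarrow> src G x = u \<Longrightarrow> gcomp G x u = x"
  and comp_unit_left: "x \<in> arrows G \<Longrightarrow> u \<in> units G \<Longrightarrow> rng G x = u \<Longrightarrow> gcomp G u x = x"
  by (auto simp: comp_src rng_comp_left)

lemma comp_inv_cancel_left:
  assumes "x \<in> arrows G" "y \<in> arrows G" "src G x = rng G y"
  shows "gcomp G (ginv G x) (gcomp G x y) = y"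
  using assms gcomp_assoc [of "ginv G x" x y] by (simp add: groupoid_simps)

lemma comp_inv_cancel_right:
  assumes "x \<in> arrows G" "y \<in> arrows G" "src G x = rng G y"
  shows "gcomp G (gcomp G x y) (ginv G y) = x"
  using assms gcomp_assoc [of x y "ginv G y"] by (simp add: groupoid_simps flip: assms(3))

lemma comp_inv_cancel_right':
  assumes "x \<in> arrows G" "y \<in> arrows G" "src G x = src G y"
  shows "gcomp G (gcomp G x (ginv G y)) y = x"
  using assms gcomp_assoc [of x "ginv G y" y] by (simp add: groupoid_simps flip: assms(3))

text \<open>Uniqueness of inverses: the product of \<open>ginv G z\<close>, \<open>z\<close> and the
  candidate inverse, for z = xy, is bracketed in two ways.\<close>

lemma inv_comp:
  assumes "x \<in> arrows G" "y \<in> arrows G" "src G x = rng G y"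
  shows "ginv G (gcomp G x y) = gcomp G (ginv G y) (ginv G x)"
proof -
  let ?z = "gcomp G x y"
  have "gcomp G (gcomp G (ginv G ?z) ?z) (gcomp G (ginv G y) (ginv G x))
      = gcomp G (ginv G ?z) (gcomp G ?z (gcomp G (ginv G y) (ginv G x)))"
    using assms by (intro gcomp_assoc) (simp_all add: groupoid_simps)
  moreover have "gcomp G ?z (gcomp G (ginv G y) (ginv G x)) = rng G x"
    using assms gcomp_assoc [of ?z "ginv G y" "ginv G x"]
    by (simp add: groupoid_simps comp_inv_cancel_right)
  moreover have "gcomp G (gcomp G (ginv G ?z) ?z) (gcomp G (ginv G y) (ginv G x))
      = gcomp G (ginv G y) (ginv G x)"
    using assms
    by (simp add: groupoid_simps comp_unit_left src_in_units)
  moreover have "gcomp G (ginv G ?z) (rng G x) = ginv G ?z"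
    using assms by (intro comp_unit_right) (simp_all add: groupoid_simps rng_in_units)
  ultimately show ?thesis by simp
qed

section \<open>Products of sets of arrows\<close>

lemma setcomp_iff:
  "c \<in> setcomp G A B \<longleftrightarrow>
     (\<exists>a b. c = gcomp G a b \<and> a \<in> A \<and> b \<in> B \<and> a \<in> arrows G \<and> b \<in> arrows G \<and> src G a = rng G b)"
  by (auto simp: setcomp_def composable_def)

lemma setcompI:
  "a \<in> A \<Longrightarrow> b \<in> B \<Longrightarrow> a \<in> arrows G \<Longrightarrow> b \<in> arrows G \<Longrightarrow> src G a = rng G b
    \<Longrightarrow> gcomp G a b \<in> setcomp G A B"
  by (auto simp: setcomp_iff)

lemma setcomp_assoc: "setcomp G (setcomp G A B) C = setcomp G A (setcomp G B C)"
proof (intro Set.set_eqI iffI)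
  fix x assume "x \<in> setcomp G (setcomp G A B) C"
  then obtain a b c where h: "x = gcomp G (gcomp G a b) c" "a \<in> A" "b \<in> B" "c \<in> C"
    "a \<in> arrows G" "b \<in> arrows G" "c \<in> arrows G" "src G a = rng G b" "src G b = rng G c"
    by (auto simp: setcomp_iff groupoid_simps)
  then have "x = gcomp G a (gcomp G b c)"
    by (simp add: gcomp_assoc)
  then show "x \<in> setcomp G A (setcomp G B C)"
    using h by (auto intro!: setcompI simp: groupoid_simps)
next
  fix x assume "x \<in> setcomp G A (setcomp G B C)"
  then obtain a b c where h: "x = gcomp G a (gcomp G b c)" "a \<in> A" "b \<in> B" "c \<in> C"
    "a \<in> arrows G" "b \<in> arrows G" "c \<in> arrows G" "src G a = rng G b" "src G b = rng G c"
    by (auto simp: setcomp_iff groupoid_simps)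
  then have "x = gcomp G (gcomp G a b) c"
    by (simp add: gcomp_assoc)
  then show "x \<in> setcomp G (setcomp G A B) C"
    using h by (auto intro!: setcompI simp: groupoid_simps)
qed

lemma setcomp_units_right:
  assumes "A \<subseteq> arrows G"
  shows "setcomp G A (units G) = A"
proof (intro Set.set_eqI iffI)
  fix x assume "x \<in> setcomp G A (units G)"
  then show "x \<in> A"
    by (auto simp: setcomp_iff rng_unit comp_unit_right)
next
  fix x assume "x \<in> A"
  then show "x \<in> setcomp G A (units G)"
    using assms setcompI [of x A "src G x" "units G"]
    by (auto simp: src_in_units src_in_arrows rng_src comp_src subset_iff)
qed

lemma setcomp_units_left:
  assumes "A \<subseteq> arrows G"
  shows "setcomp G (units G) A = A"
proof (intro Set.set_eqI iffI)
  fix x assume "x \<in> setcomp G (units G) A"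
  then show "x \<in> A"
    by (auto simp: setcomp_iff src_unit comp_unit_left)
next
  fix x assume "x \<in> A"
  then show "x \<in> setcomp G (units G) A"
    using assms setcompI [of "rng G x" "units G" x A]
    by (auto simp: rng_in_units rng_in_arrows src_rng rng_comp_left subset_iff)
qed

end

section \<open>Compact open sets and bisections\<close>

lemma compact_open_subset:
  assumes U: "compact_open X U" and "openin X V" "compactin X V" "V \<subseteq> U"
  shows "compact_open X V"
proof -
  have "subtopology (subtopology X U) V = subtopology X V"
    using assms(4) by (simp add: subtopology_subtopology inf.absorb2)
  then show ?thesis
    using assms Hausdorff_space_subtopology [of "subtopology X U" V] by (auto simp: compact_open_def)
qed

text \<open>Inside the Hausdorff set \<open>U\<close> compact sets are closed, so intersections and
  differences of compact open subsets stay compact. Without a common \<open>U\<close> this can fail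
  in a non-Hausdorff space.\<close>

lemma
  assumes U: "compact_open X U" and V: "compact_open X V" "V \<subseteq> U" and W: "compact_open X W" "W \<subseteq> U"
  shows compact_open_Int: "compact_open X (V \<inter> W)"
    and compact_open_Diff: "compact_open X (V - W)"
proof -
  let ?Y = "subtopology X U"
  have c: "compactin ?Y V" "compactin ?Y W" and H: "Hausdorff_space ?Y" and o: "openin X U"
    "openin X V" "openin X W"
    using assms by (auto simp: compact_open_def compactin_subtopology)
  have ts: "topspace ?Y = U"
    using o openin_subset by fastforce
  have cl: "closedin ?Y W"
    using H c compactin_imp_closedin by blast
  have "openin ?Y W"
    using o W by (simp add: openin_open_subtopology)
  then have cl': "closedin ?Y (U - W)"
    using ts by (metis openin_closedin_eq closedin_diff closedin_topspace)
  have eq: "V - W = V \<inter> (U - W)"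
    using V by auto
  have "compactin ?Y (V \<inter> W)"
    using c cl compact_Int_closedin by blast
  then show "compact_open X (V \<inter> W)"
    using o V by (intro compact_open_subset [OF U]) (auto simp: compactin_subtopology)
  have "compactin ?Y (V - W)"
    unfolding eq using c cl' compact_Int_closedin by blast
  moreover have "openin X (V - W)"
  proof -
    have "openin ?Y (V - W)"
      using o V cl by (intro openin_diff) (auto simp: openin_open_subtopology)
    then show ?thesis
      using o by (simp add: openin_open_subtopology)
  qed
  ultimately show "compact_open X (V - W)"
    using V by (intro compact_open_subset [OF U]) (auto simp: compactin_subtopology)
qed

lemma compact_open_Un:
  assumes U: "compact_open X U" and V: "compact_open X V" "V \<subseteq> U" and W: "compact_open X W" "W \<subseteq> U"
  shows "compact_open X (V \<union> W)"
  using V W by (intro compact_open_subset [OF U]) (auto simp: compact_open_def compactin_Un)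

text \<open>The local-to-global principle of the whole proof. Compactness gives a finite cover by
  good sets \<open>W\<close>. To make the cover disjoint it is cut into pieces, and
  \<open>basis\<close> therefore demands \<open>P\<close> for all compact open subsets of
  \<open>W\<close>, not just for \<open>W\<close>.\<close>

lemma compact_open_induct [consumes 1, case_names empty basis union]:
  assumes U: "compact_open X U"
    and empty: "P {}"
    and basis: "\<And>x. x \<in> U \<Longrightarrow> \<exists>W. compact_open X W \<and> x \<in> W \<and> W \<subseteq> U \<and>
          (\<forall>V. compact_open X V \<and> V \<subseteq> W \<longrightarrow> P V)"
    and union: "\<And>V W. compact_open X V \<Longrightarrow> compact_open X W \<Longrightarrow> V \<subseteq> U \<Longrightarrow> W \<subseteq> U \<Longrightarrow> V \<inter> W = {}
          \<Longrightarrow> P V \<Longrightarrow> P W \<Longrightarrow> P (V \<union> W)"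
  shows "P U"
proof -
  obtain w where w: "\<And>x. x \<in> U \<Longrightarrow> compact_open X (w x) \<and> x \<in> w x \<and> w x \<subseteq> U \<and>
          (\<forall>V. compact_open X V \<and> V \<subseteq> w x \<longrightarrow> P V)"
    using basis by metis
  have "compactin X U"
    using U by (simp add: compact_open_def)
  moreover have "\<forall>W \<in> w ` U. openin X W"
    using w by (auto simp: compact_open_def)
  moreover have "U \<subseteq> \<Union>(w ` U)"
    using w by blast
  ultimately obtain \<F> where F: "finite \<F>" "\<F> \<subseteq> w ` U" "U \<subseteq> \<Union>\<F>"
    using compactinD [of X U "w ` U"] by blast
  \<comment> \<open>Generalised to every compact open \<open>V\<close> covered by the finite family,
    because the induction step splits \<open>V\<close> into its part inside the new set
    \<open>W\<close> and its part outside.\<close>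
  have "\<forall>V. compact_open X V \<and> V \<subseteq> U \<and> V \<subseteq> \<Union>\<F> \<longrightarrow> P V"
    using F(1,2)
  proof (induction \<F> rule: finite_induct)
    case empty
    then show ?case using assms(2) by auto
  next
    case (insert W \<F>)
    then have W: "compact_open X W" "W \<subseteq> U" "\<And>V. compact_open X V \<Longrightarrow> V \<subseteq> W \<Longrightarrow> P V"
      using w by auto
    show ?case
    proof (intro allI impI, elim conjE)
      fix V assume V: "compact_open X V" "V \<subseteq> U" "V \<subseteq> \<Union>(insert W \<F>)"
      have co: "compact_open X (V \<inter> W)" "compact_open X (V - W)"
        using compact_open_Int [OF U V(1,2) W(1,2)] compact_open_Diff [OF U V(1,2) W(1,2)] by auto
      have "P ((V \<inter> W) \<union> (V - W))"
        using V co W(3) insert by (intro union) auto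
      moreover have "(V \<inter> W) \<union> (V - W) = V"
        by blast
      ultimately show "P V" by simp
    qed
  qed
  then show ?thesis
    using U F by blast
qed

section \<open>Continuity of the structure maps\<close>

context topological_groupoid begin

lemma continuous_map_gcomp:
  assumes "continuous_map X (gtop G) f" "continuous_map X (gtop G) g"
    and "\<And>x. x \<in> topspace X \<Longrightarrow> src G (f x) = rng G (g x)"
  shows "continuous_map X (gtop G) (\<lambda>x. gcomp G (f x) (g x))"
proof -
  have "continuous_map X (subtopology (prod_topology (gtop G) (gtop G)) (composable G)) (\<lambda>x. (f x, g x))"
    using assms
    by (intro continuous_map_into_subtopology continuous_map_pairedI)
       (auto simp: composable_def arrows_def dest: continuous_map_image_subset_topspace)
  from continuous_map_compose [OF this continuous_comp] show ?thesis
    by (simp add: o_def)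
qed

lemma topspace_gtop [simp]: "topspace (gtop G) = arrows G"
  by (simp add: arrows_def)

lemma topspace_unit_space [simp]: "topspace (unit_space G) = units G"
  using units_subset_arrows by (auto simp: unit_space_def)

lemma continuous_map_src: "continuous_map (gtop G) (gtop G) (src G)"
  unfolding src_def
  by (intro continuous_map_gcomp continuous_inv continuous_map_id [unfolded id_def]) (simp_all add: src_inv)

lemma continuous_map_rng: "continuous_map (gtop G) (gtop G) (rng G)"
  unfolding rng_def
  by (intro continuous_map_gcomp continuous_inv continuous_map_id [unfolded id_def]) (simp_all add: rng_inv)

lemma continuous_map_src_unit_space: "continuous_map (gtop G) (unit_space G) (src G)"
  unfolding unit_space_def
  by (intro continuous_map_into_subtopology continuous_map_src) (simp add: src_in_units)

lemma continuous_map_rng_unit_space: "continuous_map (gtop G) (unit_space G) (rng G)"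
  unfolding unit_space_def
  by (intro continuous_map_into_subtopology continuous_map_rng) (simp add: rng_in_units)

lemma homeomorphic_map_inv: "homeomorphic_map (gtop G) (gtop G) (ginv G)"
  unfolding homeomorphic_map_maps homeomorphic_maps_def
  using continuous_inv inv_inv by auto

lemma inv_image_inv_image: "F \<subseteq> arrows G \<Longrightarrow> ginv G ` ginv G ` F = F"
  by (force simp: inv_inv image_image subset_iff)

lemma bisection_subset_arrows: "bisection G F \<Longrightarrow> F \<subseteq> arrows G"
  unfolding bisection_def compact_open_def by (metis openin_subset topspace_gtop)

lemma
  assumes "bisection G F"
  shows bisection_openin: "openin (gtop G) F"
    and bisection_compactin: "compactin (gtop G) F"
    and bisection_compact_open: "compact_open (gtop G) F"
    and bisection_inj_src: "inj_on (src G) F"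
    and bisection_inj_rng: "inj_on (rng G) F"
  using assms bisection_subset_arrows [OF assms]
  by (auto simp: bisection_def compact_open_def homeomorphic_eq_everything_map inf.absorb2)

end

context etale_groupoid begin

text \<open>In a bisection \<open>F\<close> around a unit, an arrow whose source also lies in
  \<open>F\<close> has the same source as that source, hence equals it and is a unit. Such arrows
  form an open neighbourhood.\<close>

lemma openin_units: "openin (gtop G) (units G)"
proof (subst openin_subopen, intro ballI)
  fix u assume u: "u \<in> units G"
  obtain F where F: "bisection G F" "u \<in> F"
    using bisection_basis [OF openin_topspace, of u] u unit_in_arrows by auto
  let ?W = "{x \<in> F. src G x \<in> F}"
  have "openin (gtop G) ?W"
    using F by (intro openin_continuous_map_preimage_gen [OF continuous_map_src]) (auto intro: bisection_openin)
  moreover have "?W \<subseteq> units G"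
  proof clarify
    fix x assume x: "x \<in> F" "src G x \<in> F"
    then have "x \<in> arrows G"
      using F bisection_subset_arrows by blast
    then have "src G x = x"
      using inj_onD [OF bisection_inj_src [OF F(1)] _ x(2,1)] by (simp add: src_src)
    then show "x \<in> units G"
      using src_in_units [OF \<open>x \<in> arrows G\<close>] by simp
  qed
  ultimately show "\<exists>T. openin (gtop G) T \<and> u \<in> T \<and> T \<subseteq> units G"
    using F u by (intro exI [of _ ?W]) (auto simp: src_unit)
qed

lemma openin_unit_space: "openin (unit_space G) U \<longleftrightarrow> openin (gtop G) U \<and> U \<subseteq> units G"
  by (simp add: unit_space_def openin_open_subtopology openin_units)

lemma compactin_unit_space: "compactin (unit_space G) U \<longleftrightarrow> compactin (gtop G) U \<and> U \<subseteq> units G"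
  by (simp add: unit_space_def compactin_subtopology)

lemma compact_open_unit_space:
  "compact_open (unit_space G) U \<longleftrightarrow> compact_open (gtop G) U \<and> U \<subseteq> units G"
  unfolding compact_open_def openin_unit_space compactin_unit_space
  by (auto simp: unit_space_def subtopology_subtopology Int_absorb1)

lemma open_image_src:
  assumes "openin (gtop G) U"
  shows "openin (gtop G) (src G ` U)"
proof (subst openin_subopen, intro ballI)
  fix y assume "y \<in> src G ` U"
  then obtain x where x: "x \<in> U" "y = src G x" by auto
  obtain F where F: "bisection G F" "x \<in> F" "F \<subseteq> U"
    using bisection_basis assms x by blast
  then show "\<exists>T. openin (gtop G) T \<and> y \<in> T \<and> T \<subseteq> src G ` U"
    using x by (intro exI [of _ "src G ` F"]) (auto simp: bisection_def openin_unit_space)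
qed

lemma open_image_inv:
  assumes "openin (gtop G) U"
  shows "openin (gtop G) (ginv G ` U)"
  using homeomorphic_imp_open_map [OF homeomorphic_map_inv] assms by (auto simp: open_map_def)

lemma src_image_inv: "F \<subseteq> arrows G \<Longrightarrow> src G ` ginv G ` F = rng G ` F"
  and rng_image_inv: "F \<subseteq> arrows G \<Longrightarrow> rng G ` ginv G ` F = src G ` F"
  by (auto simp: image_image src_inv rng_inv subset_iff intro!: image_cong)

lemma open_image_rng:
  assumes "openin (gtop G) U"
  shows "openin (gtop G) (rng G ` U)"
  using open_image_src [OF open_image_inv [OF assms]] openin_subset [OF assms]
  by (simp add: src_image_inv)

end

text \<open>The two topological properties of the unit space that are carried over from the Cantor
  space by the homeomorphism.\<close>

locale compact_etale_groupoid = etale_groupoid +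
  assumes Hausdorff_units: "Hausdorff_space (unit_space G)"
    and compact_units: "compact_space (unit_space G)"
begin

text \<open>An injective continuous map into the Hausdorff unit space makes \<open>F\<close>
  Hausdorff, and a continuous bijection from a compact space to a Hausdorff one is a homeomorphism.
  Being a bisection thus reduces to openness, compactness and two injectivity conditions.\<close>

lemma bisectionI:
  assumes F: "openin (gtop G) F" "compactin (gtop G) F" and inj: "inj_on (src G) F" "inj_on (rng G) F"
  shows "bisection G F"
proof -
  let ?X = "subtopology (gtop G) F"
  have sub: "F \<subseteq> arrows G"
    using F(1) openin_subset by fastforce
  then have ts: "topspace ?X = F"
    by auto
  have H: "Hausdorff_space ?X"
    using inj(1) ts
    by (intro Hausdorff_space_injective_preimage [OF Hausdorff_units
          continuous_map_from_subtopology [OF continuous_map_src_unit_space]]) auto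
  have cpt: "compact_space ?X"
    using F(2) by (simp add: compact_space_subtopology)
  have homeo: "homeomorphic_map ?X (subtopology (unit_space G) (f ` F)) f"
    if f: "continuous_map (gtop G) (unit_space G) f" "inj_on f F" for f
  proof (rule continuous_imp_homeomorphic_map [OF _ cpt])
    show "continuous_map ?X (subtopology (unit_space G) (f ` F)) f"
      using f ts by (intro continuous_map_into_subtopology continuous_map_from_subtopology) auto
    show "Hausdorff_space (subtopology (unit_space G) (f ` F))"
      by (rule Hausdorff_space_subtopology [OF Hausdorff_units])
    show "f ` topspace ?X = topspace (subtopology (unit_space G) (f ` F))"
      using continuous_map_image_subset_topspace [OF f(1)] sub ts by auto
    show "inj_on f (topspace ?X)"
      using f ts by simp
  qed
  show ?thesis
    unfolding bisection_def compact_open_def openin_unit_space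
    using F H homeo continuous_map_src_unit_space continuous_map_rng_unit_space inj
      open_image_src open_image_rng sub
    by (auto simp: src_in_units rng_in_units subset_iff)
qed

lemma bisection_iff:
  "bisection G F \<longleftrightarrow> openin (gtop G) F \<and> compactin (gtop G) F \<and> inj_on (src G) F \<and> inj_on (rng G) F"
  using bisectionI bisection_openin bisection_compactin bisection_inj_src bisection_inj_rng by blast

lemma bisection_subset:
  assumes "bisection G F" "compact_open (gtop G) V" "V \<subseteq> F"
  shows "bisection G V"
  using assms inj_on_subset unfolding bisection_iff compact_open_def by blast

lemma compact_open_imp_bisection:
  assumes "compact_open (gtop G) U" "U \<subseteq> units G"
  shows "bisection G U"
proof -
  have "inj_on (src G) U" "inj_on (rng G) U"
    using assms(2) by (auto simp: inj_on_def src_unit rng_unit subset_iff)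
  then show ?thesis
    using assms by (simp add: bisection_iff compact_open_def)
qed

lemma compact_open_units: "compact_open (gtop G) (units G)"
proof -
  have "compactin (gtop G) (units G)"
    using compact_units unfolding compact_space_def by (simp add: compactin_unit_space)
  then show ?thesis
    using Hausdorff_units openin_units by (simp add: compact_open_def unit_space_def)
qed

lemma bisection_units: "bisection G (units G)"
  by (simp add: compact_open_units compact_open_imp_bisection)

lemma bisection_inv:
  assumes "bisection G F"
  shows "bisection G (ginv G ` F)"
proof (rule bisectionI)
  show "openin (gtop G) (ginv G ` F)"
    using assms open_image_inv bisection_openin by blast
  show "compactin (gtop G) (ginv G ` F)"
    using assms bisection_compactin continuous_inv image_compactin by blast
  show "inj_on (src G) (ginv G ` F)" "inj_on (rng G) (ginv G ` F)"
    using bisection_subset_arrows [OF assms] bisection_inj_src [OF assms] bisection_inj_rng [OF assms]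
    by (auto simp: inj_on_def src_inv rng_inv subset_iff)
qed

lemma bisection_Un:
  assumes "bisection G F" "bisection G H" "src G ` F \<inter> src G ` H = {}" "rng G ` F \<inter> rng G ` H = {}"
  shows "bisection G (F \<union> H)"
  using assms unfolding bisection_iff
  by (auto simp: compactin_Un inj_on_Un)

lemma compact_open_src:
  assumes "bisection G F"
  shows "compact_open (gtop G) (src G ` F)" "src G ` F \<subseteq> units G"
proof -
  show "src G ` F \<subseteq> units G"
    using bisection_subset_arrows [OF assms] by (auto simp: src_in_units)
  then show "compact_open (gtop G) (src G ` F)"
    using assms open_image_src image_compactin [OF _ continuous_map_src]
    by (intro compact_open_subset [OF compact_open_units]) (auto simp: bisection_iff)
qed

lemma compact_open_rng:
  assumes "bisection G F"
  shows "compact_open (gtop G) (rng G ` F)" "rng G ` F \<subseteq> units G"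
  using compact_open_src [OF bisection_inv [OF assms]] bisection_subset_arrows [OF assms]
  by (simp_all add: src_image_inv)

text \<open>Makes the arrow of a bisection over a given unit depend continuously on that unit;
  products of bisections are parametrised this way.\<close>

lemma continuous_section:
  assumes "bisection G F"
  shows "continuous_map (subtopology (gtop G) (src G ` F)) (gtop G) (inv_into F (src G))"
    and "continuous_map (subtopology (gtop G) (rng G ` F)) (gtop G) (inv_into F (rng G))"
proof -
  have *: "continuous_map (subtopology (gtop G) (f ` F)) (gtop G) (inv_into F f)"
    if f: "homeomorphic_map (subtopology (gtop G) F) (subtopology (unit_space G) (f ` F)) f"
      "f ` F \<subseteq> units G" for f
  proof -
    have ts: "topspace (subtopology (gtop G) F) = F"
      using bisection_subset_arrows [OF assms] by auto
    obtain g where g: "homeomorphic_maps (subtopology (gtop G) F) (subtopology (unit_space G) (f ` F)) f g"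
      using f homeomorphic_map_maps by blast
    have *: "subtopology (unit_space G) (f ` F) = subtopology (gtop G) (f ` F)"
      using f(2) by (simp add: unit_space_def subtopology_subtopology inf.absorb2)
    have "continuous_map (subtopology (gtop G) (f ` F)) (gtop G) g"
      using g unfolding homeomorphic_maps_def * by (metis continuous_map_into_fulltopology)
    moreover have "inv_into F f y = g y" if "y \<in> f ` F" for y
    proof (rule inv_into_f_eq)
      show "inj_on f F"
        using f(1) ts by (simp add: homeomorphic_eq_everything_map)
      show "g y \<in> F" "f (g y) = y"
        using g that f(2) ts units_subset_arrows unfolding homeomorphic_maps_def continuous_map_def * by auto
    qed
    ultimately show ?thesis
      by (elim continuous_map_eq) auto
  qed
  show "continuous_map (subtopology (gtop G) (src G ` F)) (gtop G) (inv_into F (src G))"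
    "continuous_map (subtopology (gtop G) (rng G ` F)) (gtop G) (inv_into F (rng G))"
    using assms compact_open_src(2) [OF assms] compact_open_rng(2) [OF assms]
    by (auto intro!: * simp: bisection_def)
qed

text \<open>An arrow c lies in AB exactly if its source lies in s(B) and c b^{-1} lies in A, where b
  is the only arrow of B with the source of c. As b depends continuously on c, this is an open
  condition.\<close>

lemma openin_setcomp:
  assumes A: "openin (gtop G) A" and B: "bisection G B"
  shows "openin (gtop G) (setcomp G A B)"
proof -
  let ?\<beta> = "inv_into B (src G)" and ?X = "{c \<in> arrows G. src G c \<in> src G ` B}"
  have Bsub: "B \<subseteq> arrows G" and Asub: "A \<subseteq> arrows G"
    using B bisection_subset_arrows openin_subset [OF A] by auto
  have \<beta>: "?\<beta> (src G c) \<in> B" "src G (?\<beta> (src G c)) = src G c" "?\<beta> (src G c) \<in> arrows G"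
    if "src G c \<in> src G ` B" for c
    using inv_into_into [OF that] f_inv_into_f [OF that] Bsub by auto
  have X: "openin (gtop G) ?X"
    using openin_continuous_map_preimage [OF continuous_map_src open_image_src [OF bisection_openin [OF B]]]
    by simp
  have "continuous_map (subtopology (gtop G) ?X) (gtop G) (\<lambda>c. ginv G (?\<beta> (src G c)))"
  proof -
    have "continuous_map (subtopology (gtop G) ?X) (subtopology (gtop G) (src G ` B)) (src G)"
      by (intro continuous_map_into_subtopology continuous_map_from_subtopology continuous_map_src) auto
    from continuous_map_compose [OF continuous_map_compose [OF this continuous_section(1) [OF B]] continuous_inv]
    show ?thesis by (simp add: o_def)
  qed
  then have c: "continuous_map (subtopology (gtop G) ?X) (gtop G) (\<lambda>c. gcomp G c (ginv G (?\<beta> (src G c))))"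
    using \<beta> by (intro continuous_map_gcomp)
       (auto intro: continuous_map_from_subtopology continuous_map_id [unfolded id_def] simp: rng_inv)
  have "setcomp G A B = {c \<in> topspace (subtopology (gtop G) ?X). gcomp G c (ginv G (?\<beta> (src G c))) \<in> A}"
    (is "_ = ?R")
  proof (intro Set.set_eqI iffI)
    fix c assume "c \<in> setcomp G A B"
    then obtain a b where h: "c = gcomp G a b" "a \<in> A" "b \<in> B" "a \<in> arrows G" "b \<in> arrows G" "src G a = rng G b"
      by (auto simp: setcomp_iff)
    then have "src G c = src G b" "c \<in> arrows G"
      by (simp_all add: groupoid_simps)
    moreover have "?\<beta> (src G b) = b"
      using h bisection_inj_src [OF B] by simp
    ultimately show "c \<in> ?R"
      using h by (auto simp: comp_inv_cancel_right)
  next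
    fix c assume c: "c \<in> ?R"
    then have "gcomp G (gcomp G c (ginv G (?\<beta> (src G c)))) (?\<beta> (src G c)) \<in> setcomp G A B"
      using \<beta> by (intro setcompI) (auto simp: groupoid_simps)
    then show "c \<in> setcomp G A B"
      using c \<beta> by (simp add: comp_inv_cancel_right')
  qed
  then have "openin (subtopology (gtop G) ?X) (setcomp G A B)"
    using openin_continuous_map_preimage [OF c A] by simp
  then show ?thesis
    using X by (simp add: openin_open_subtopology)
qed

lemma bisection_setcomp:
  assumes A: "bisection G A" and B: "bisection G B"
  shows "bisection G (setcomp G A B)"
proof (rule bisectionI)
  have Asub: "A \<subseteq> arrows G" and Bsub: "B \<subseteq> arrows G"
    using A B bisection_subset_arrows by auto
  show "openin (gtop G) (setcomp G A B)"
    using assms openin_setcomp bisection_openin by blast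
  show "inj_on (src G) (setcomp G A B)"
  proof (intro inj_onI)
    fix x y assume xy: "x \<in> setcomp G A B" "y \<in> setcomp G A B" and eq: "src G x = src G y"
    obtain a b where h: "x = gcomp G a b" "a \<in> A" "b \<in> B" "a \<in> arrows G" "b \<in> arrows G" "src G a = rng G b"
      using xy(1) by (auto simp: setcomp_iff)
    obtain a' b' where h': "y = gcomp G a' b'" "a' \<in> A" "b' \<in> B" "a' \<in> arrows G" "b' \<in> arrows G" "src G a' = rng G b'"
      using xy(2) by (auto simp: setcomp_iff)
    have "b = b'"
      using eq h h' inj_onD [OF bisection_inj_src [OF B]] by (simp add: groupoid_simps)
    moreover have "a = a'"
      using h h' \<open>b = b'\<close> inj_onD [OF bisection_inj_src [OF A]] by simp
    ultimately show "x = y"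
      using h h' by simp
  qed
  show "inj_on (rng G) (setcomp G A B)"
  proof (intro inj_onI)
    fix x y assume xy: "x \<in> setcomp G A B" "y \<in> setcomp G A B" and eq: "rng G x = rng G y"
    obtain a b where h: "x = gcomp G a b" "a \<in> A" "b \<in> B" "a \<in> arrows G" "b \<in> arrows G" "src G a = rng G b"
      using xy(1) by (auto simp: setcomp_iff)
    obtain a' b' where h': "y = gcomp G a' b'" "a' \<in> A" "b' \<in> B" "a' \<in> arrows G" "b' \<in> arrows G" "src G a' = rng G b'"
      using xy(2) by (auto simp: setcomp_iff)
    have "a = a'"
      using eq h h' inj_onD [OF bisection_inj_rng [OF A]] by (simp add: groupoid_simps)
    moreover have "b = b'"
      using h h' \<open>a = a'\<close> inj_onD [OF bisection_inj_rng [OF B]] by simp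
    ultimately show "x = y"
      using h h' by simp
  qed
  \<comment> \<open>Compactness: AB is parametrised by the unit y in the middle of each product, and
    these units form the compact open set \<open>?V\<close>.\<close>
  let ?V = "src G ` A \<inter> rng G ` B" and ?\<alpha> = "inv_into A (src G)" and ?\<beta> = "inv_into B (rng G)"
  have \<alpha>: "?\<alpha> y \<in> A" "?\<alpha> y \<in> arrows G" "src G (?\<alpha> y) = y" if "y \<in> ?V" for y
    using inv_into_into [of y "src G" A] f_inv_into_f [of y "src G" A] that Asub by auto
  have \<beta>: "?\<beta> y \<in> B" "?\<beta> y \<in> arrows G" "rng G (?\<beta> y) = y" if "y \<in> ?V" for y
    using inv_into_into [of y "rng G" B] f_inv_into_f [of y "rng G" B] that Bsub by auto
  have V: "compact_open (gtop G) ?V"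
    using compact_open_Int [OF compact_open_units] compact_open_src [OF A] compact_open_rng [OF B] by blast
  have c: "continuous_map (subtopology (gtop G) ?V) (gtop G) (\<lambda>y. gcomp G (?\<alpha> y) (?\<beta> y))"
    using \<alpha> \<beta>
    by (intro continuous_map_gcomp continuous_map_from_subtopology_mono [OF continuous_section(1) [OF A]]
        continuous_map_from_subtopology_mono [OF continuous_section(2) [OF B]]) auto
  have "setcomp G A B = (\<lambda>y. gcomp G (?\<alpha> y) (?\<beta> y)) ` ?V"
  proof (intro Set.set_eqI iffI)
    fix x assume "x \<in> setcomp G A B"
    then obtain a b where h: "x = gcomp G a b" "a \<in> A" "b \<in> B" "a \<in> arrows G" "b \<in> arrows G" "src G a = rng G b"
      by (auto simp: setcomp_iff)
    then have "?\<alpha> (rng G b) = a" "?\<beta> (rng G b) = b"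
      using inv_into_f_f [OF bisection_inj_src [OF A], of a] inv_into_f_f [OF bisection_inj_rng [OF B], of b]
      by auto
    then show "x \<in> (\<lambda>y. gcomp G (?\<alpha> y) (?\<beta> y)) ` ?V"
      using h(1-3) imageI [of a A "src G"] h(6) by (intro image_eqI [of _ _ "rng G b"]) simp_all
  next
    fix x assume "x \<in> (\<lambda>y. gcomp G (?\<alpha> y) (?\<beta> y)) ` ?V"
    then obtain y where y: "x = gcomp G (?\<alpha> y) (?\<beta> y)" "y \<in> ?V"
      by blast
    then show "x \<in> setcomp G A B"
      unfolding y(1) using \<alpha> [OF y(2)] \<beta> [OF y(2)] by (intro setcompI) simp_all
  qed
  then show "compactin (gtop G) (setcomp G A B)"
    using V image_compactin [OF _ c, of ?V] by (simp add: compactin_subtopology compact_open_def)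
qed

end

section \<open>The full group and multisections\<close>

context compact_etale_groupoid begin

text \<open>Injectivity of the range (respectively the source) on \<open>F\<close> forces both
  factors of a defined product to come from the same arrow.\<close>

lemma inv_image_setcomp:
  assumes "bisection G F"
  shows "setcomp G (ginv G ` F) F = src G ` F" "setcomp G F (ginv G ` F) = rng G ` F"
proof -
  have sub: "F \<subseteq> arrows G"
    using assms bisection_subset_arrows by blast
  show "setcomp G (ginv G ` F) F = src G ` F"
  proof (intro equalityI subsetI)
    fix x assume "x \<in> setcomp G (ginv G ` F) F"
    then obtain a b where h: "x = gcomp G (ginv G a) b" "a \<in> F" "b \<in> F" "src G (ginv G a) = rng G b"
      by (auto simp: setcomp_iff)
    then have "a = b"
      using sub inj_onD [OF bisection_inj_rng [OF assms], of a b] by (auto simp: src_inv)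
    then show "x \<in> src G ` F"
      using h by (simp add: gcomp_inv_left)
  next
    fix x assume "x \<in> src G ` F"
    then obtain a where "a \<in> F" "x = gcomp G (ginv G a) a"
      by (auto simp: gcomp_inv_left)
    then show "x \<in> setcomp G (ginv G ` F) F"
      using sub by (simp only:, intro setcompI) (auto simp: inv_closed src_inv)
  qed
  show "setcomp G F (ginv G ` F) = rng G ` F"
  proof (intro equalityI subsetI)
    fix x assume "x \<in> setcomp G F (ginv G ` F)"
    then obtain a b where h: "x = gcomp G b (ginv G a)" "a \<in> F" "b \<in> F" "src G b = rng G (ginv G a)"
      by (auto simp: setcomp_iff)
    then have "a = b"
      using sub inj_onD [OF bisection_inj_src [OF assms], of a b] by (auto simp: rng_inv)
    then show "x \<in> rng G ` F"
      using h by (simp add: gcomp_inv)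
  next
    fix x assume "x \<in> rng G ` F"
    then obtain a where "a \<in> F" "x = gcomp G a (ginv G a)"
      by (auto simp: gcomp_inv)
    then show "x \<in> setcomp G F (ginv G ` F)"
      using sub by (simp only:, intro setcompI) (auto simp: inv_closed rng_inv)
  qed
qed

lemma src_image_setcomp:
  assumes "A \<subseteq> arrows G" "B \<subseteq> arrows G"
  shows "src G ` setcomp G A B = {src G b | b. b \<in> B \<and> rng G b \<in> src G ` A}"
proof (intro equalityI subsetI)
  fix x assume "x \<in> src G ` setcomp G A B"
  then obtain a b where "x = src G (gcomp G a b)" "a \<in> A" "b \<in> B" "src G a = rng G b"
    by (auto simp: setcomp_iff)
  then show "x \<in> {src G b | b. b \<in> B \<and> rng G b \<in> src G ` A}"
    using assms by (auto simp: src_of_comp subset_iff intro!: exI [of _ b] image_eqI [of _ _ a])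
next
  fix x assume "x \<in> {src G b | b. b \<in> B \<and> rng G b \<in> src G ` A}"
  then obtain a b where "x = src G b" "a \<in> A" "b \<in> B" "src G a = rng G b"
    by auto
  then show "x \<in> src G ` setcomp G A B"
    using assms by (intro image_eqI [of _ _ "gcomp G a b"] setcompI) (auto simp: src_of_comp subset_iff)
qed

lemma rng_image_setcomp:
  assumes "A \<subseteq> arrows G" "B \<subseteq> arrows G"
  shows "rng G ` setcomp G A B = {rng G a | a. a \<in> A \<and> src G a \<in> rng G ` B}"
proof (intro equalityI subsetI)
  fix x assume "x \<in> rng G ` setcomp G A B"
  then obtain a b where "x = rng G (gcomp G a b)" "a \<in> A" "b \<in> B" "src G a = rng G b"
    by (auto simp: setcomp_iff)
  then show "x \<in> {rng G a | a. a \<in> A \<and> src G a \<in> rng G ` B}"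
    using assms by (auto simp: rng_of_comp subset_iff intro!: exI [of _ a])
next
  fix x assume "x \<in> {rng G a | a. a \<in> A \<and> src G a \<in> rng G ` B}"
  then obtain a b where "x = rng G a" "a \<in> A" "b \<in> B" "src G a = rng G b"
    by auto
  then show "x \<in> rng G ` setcomp G A B"
    using assms by (intro image_eqI [of _ _ "gcomp G a b"] setcompI) (auto simp: rng_of_comp subset_iff)
qed

lemma mem_full_group:
  "F \<in> carrier (full_group G) \<longleftrightarrow> bisection G F \<and> src G ` F = units G \<and> rng G ` F = units G"
  by (simp add: full_group_def)

lemma mult_full_group [simp]: "monoid.mult (full_group G) = setcomp G"
  and one_full_group [simp]: "one (full_group G) = units G"
  by (simp_all add: full_group_def)

lemma full_group_subset_arrows: "F \<in> carrier (full_group G) \<Longrightarrow> F \<subseteq> arrows G"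
  using mem_full_group bisection_subset_arrows by blast

text \<open>A member of the full group has exactly one arrow over each unit, so it cannot be
  properly contained in another. Identities in the full group need only one inclusion because of
  this.\<close>

lemma full_group_eqI:
  assumes A: "A \<in> carrier (full_group G)" and B: "B \<in> carrier (full_group G)" and sub: "A \<subseteq> B"
  shows "A = B"
proof (rule equalityI [OF sub], rule subsetI)
  fix b assume b: "b \<in> B"
  then have "src G b \<in> src G ` A"
    using A B by (metis imageI mem_full_group)
  then obtain a where "a \<in> A" "src G a = src G b"
    by auto
  then show "b \<in> A"
    using B b sub inj_onD [of "src G" B a b] bisection_inj_src mem_full_group by blast
qed

lemma group_full_group: "group (full_group G)"
proof (rule groupI)
  fix A B assume A: "A \<in> carrier (full_group G)" and B: "B \<in> carrier (full_group G)"
  have "src G ` setcomp G A B = units G" "rng G ` setcomp G A B = units G"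
    unfolding src_image_setcomp [OF full_group_subset_arrows [OF A] full_group_subset_arrows [OF B]]
      rng_image_setcomp [OF full_group_subset_arrows [OF A] full_group_subset_arrows [OF B]]
    using A B full_group_subset_arrows [OF A] full_group_subset_arrows [OF B]
    by (auto simp: mem_full_group src_in_units rng_in_units subset_iff image_iff set_eq_iff) metis+
  then show "A \<otimes>\<^bsub>full_group G\<^esub> B \<in> carrier (full_group G)"
    using A B bisection_setcomp by (simp add: mem_full_group)
next
  show "\<one>\<^bsub>full_group G\<^esub> \<in> carrier (full_group G)"
    using bisection_units by (simp add: mem_full_group src_unit rng_unit)
next
  fix A assume A: "A \<in> carrier (full_group G)"
  show "\<one>\<^bsub>full_group G\<^esub> \<otimes>\<^bsub>full_group G\<^esub> A = A"
    using full_group_subset_arrows [OF A] by (simp add: setcomp_units_left)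
  show "\<exists>B\<in>carrier (full_group G). B \<otimes>\<^bsub>full_group G\<^esub> A = \<one>\<^bsub>full_group G\<^esub>"
    using A bisection_inv [of A] full_group_subset_arrows [OF A]
    by (intro bexI [of _ "ginv G ` A"])
       (simp_all add: mem_full_group inv_image_setcomp src_image_inv rng_image_inv)
qed (simp add: setcomp_assoc)

sublocale full: group "full_group G"
  by (rule group_full_group)

lemma ginv_image_full_group:
  "A \<in> carrier (full_group G) \<Longrightarrow> ginv G ` A \<in> carrier (full_group G)"
  using bisection_inv [of A] full_group_subset_arrows [of A]
  by (simp add: mem_full_group src_image_inv rng_image_inv)

lemma inv_full_group:
  assumes "A \<in> carrier (full_group G)"
  shows "inv\<^bsub>full_group G\<^esub> A = ginv G ` A"
  using assms ginv_image_full_group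
  by (intro full.inv_equality) (simp_all add: mem_full_group inv_image_setcomp)

section \<open>Multisections and the permutations they realise\<close>

lemma bisection_UN:
  assumes "finite I" "\<And>i. i \<in> I \<Longrightarrow> bisection G (F i)"
    and "\<And>i j. i \<in> I \<Longrightarrow> j \<in> I \<Longrightarrow> i \<noteq> j \<Longrightarrow> src G ` F i \<inter> src G ` F j = {}"
    and "\<And>i j. i \<in> I \<Longrightarrow> j \<in> I \<Longrightarrow> i \<noteq> j \<Longrightarrow> rng G ` F i \<inter> rng G ` F j = {}"
  shows "bisection G (\<Union>i\<in>I. F i)"
  using assms
proof (induction I rule: finite_induct)
  case empty
  then show ?case by (simp add: bisection_iff)
next
  case (insert i I)
  then have "bisection G (F i \<union> (\<Union>i\<in>I. F i))"
  proof (intro bisection_Un)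
    show "src G ` F i \<inter> src G ` (\<Union>i\<in>I. F i) = {}"
      using insert.prems(2) [of i] insert.hyps by (fastforce simp: image_UN)
    show "rng G ` F i \<inter> rng G ` (\<Union>i\<in>I. F i) = {}"
      using insert.prems(3) [of i] insert.hyps by (fastforce simp: image_UN)
  qed auto
  then show ?case by simp
qed

lemma bisection_units_Diff:
  assumes "compact_open (gtop G) V" "V \<subseteq> units G"
  shows "bisection G (units G - V)"
  using compact_open_Diff [OF compact_open_units compact_open_units _ assms] compact_open_imp_bisection by blast

lemma src_image_units: "V \<subseteq> units G \<Longrightarrow> src G ` V = V"
  and rng_image_units: "V \<subseteq> units G \<Longrightarrow> rng G ` V = V"
  by (force simp: src_unit rng_unit)+

text \<open>Everything comes from the composition law: F_ij = F_ij F_ii bounds the source from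
  above, F_ii = F_ji F_ij from below. For x in F_ij the unit s(x) factors as ab with a in F_ji and b
  in F_ij; injectivity of the source gives b = x, hence a = x^{-1}. The range is the source of the
  inverse.\<close>

lemma
  assumes M: "multisection G d F" and ij: "i \<in> {1..d}" "j \<in> {1..d}"
  shows multisection_bisection: "bisection G (F i j)"
    and multisection_src: "src G ` F i j = F i i"
    and multisection_rng: "rng G ` F i j = F j j"
    and multisection_inv: "F j i = ginv G ` F i j"
proof -
  have b: "bisection G (F k l)" if "k \<in> {1..d}" "l \<in> {1..d}" for k l
    using M that by (auto simp: multisection_def)
  have sub: "F k l \<subseteq> arrows G" if "k \<in> {1..d}" "l \<in> {1..d}" for k l
    using b bisection_subset_arrows that by blast
  have c: "setcomp G (F l m) (F k l) = F k m" if "k \<in> {1..d}" "l \<in> {1..d}" "m \<in> {1..d}" for k l m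
    using M that unfolding multisection_def by blast
  have u: "F k k \<subseteq> units G" if "k \<in> {1..d}" for k
    using M that by (auto simp: multisection_def)
  show "bisection G (F i j)"
    using b ij by blast
  have s: "src G ` F i j = F i i" if ij: "i \<in> {1..d}" "j \<in> {1..d}" for i j
  proof (intro equalityI subsetI)
    fix x assume "x \<in> src G ` F i j"
    then have "x \<in> src G ` setcomp G (F i j) (F i i)"
      using ij c by simp
    then show "x \<in> F i i"
      using u ij sub [OF ij] by (auto simp: setcomp_iff src_of_comp src_unit subset_iff)
  next
    fix x assume x: "x \<in> F i i"
    then have "x \<in> setcomp G (F j i) (F i j)"
      using ij c by simp
    moreover have "src G x = x"
      using x u ij src_unit by blast
    ultimately show "x \<in> src G ` F i j"
      by (auto simp: setcomp_iff src_of_comp intro!: image_eqI)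
  qed
  then show "src G ` F i j = F i i"
    using ij by blast
  have incl: "ginv G x \<in> F j i" if ij: "i \<in> {1..d}" "j \<in> {1..d}" and x: "x \<in> F i j" for i j x
  proof -
    have xa: "x \<in> arrows G"
      using sub ij x by blast
    have "src G x \<in> setcomp G (F j i) (F i j)"
      using s [OF ij] c ij x by auto
    then obtain a b where h: "src G x = gcomp G a b" "a \<in> F j i" "b \<in> F i j" "a \<in> arrows G" "b \<in> arrows G"
      "src G a = rng G b"
      by (auto simp: setcomp_iff)
    then have "src G b = src G x"
      by (metis src_of_comp src_src xa)
    then have "b = x"
      using inj_onD [OF bisection_inj_src [OF b [OF ij]]] h x by blast
    then have "ginv G x = a"
      using h by (metis comp_inv_cancel_right src_inv inv_closed inv_unit src_in_units inv_comp inv_inv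
          comp_inv_cancel_left comp_src rng_inv gcomp_inv_left)
    then show ?thesis
      using h by simp
  qed
  show i: "F j i = ginv G ` F i j"
  proof (intro equalityI subsetI)
    fix x assume "x \<in> F j i"
    then show "x \<in> ginv G ` F i j"
      using incl [of j i x] ij sub [of j i] inv_inv [of x] by (intro image_eqI [of _ _ "ginv G x"]) auto
  qed (use incl ij in auto)
  show "rng G ` F i j = F j j"
    using s [of j i] ij i src_image_inv sub by simp
qed

lemma multisection_units: "multisection G d F \<Longrightarrow> i \<in> {1..d} \<Longrightarrow> F i i \<subseteq> units G"
  and multisection_disjoint:
    "multisection G d F \<Longrightarrow> i \<in> {1..d} \<Longrightarrow> j \<in> {1..d} \<Longrightarrow> i \<noteq> j \<Longrightarrow> F i i \<inter> F j j = {}"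
  and multisection_comp: "multisection G d F \<Longrightarrow> i \<in> {1..d} \<Longrightarrow> j \<in> {1..d} \<Longrightarrow> k \<in> {1..d}
    \<Longrightarrow> setcomp G (F j k) (F i j) = F i k"
  unfolding multisection_def by blast+

lemma multisection_perm_in_full_group:
  assumes M: "multisection G d F" and p: "p permutes {1..d}"
  shows "multisection_perm G d F p \<in> carrier (full_group G)"
proof -
  let ?P = "\<Union>i\<in>{1..d}. F i (p i)" and ?U = "\<Union>i\<in>{1..d}. F i i"
  have pin: "p i \<in> {1..d}" if "i \<in> {1..d}" for i
    using p that by (meson permutes_in_image)
  have pinj: "p i \<noteq> p j" if "i \<noteq> j" for i j
    using p that by (metis permutes_inj injD)
  note s = multisection_src [OF M] and r = multisection_rng [OF M] and dj = multisection_disjoint [OF M]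
  have P: "bisection G ?P"
    using M pin pinj by (intro bisection_UN) (simp_all add: multisection_bisection s r dj)
  have sP: "src G ` ?P = ?U"
    unfolding image_UN using s pin by (intro SUP_cong) auto
  have "rng G ` ?P = (\<Union>i\<in>{1..d}. F (p i) (p i))"
    unfolding image_UN using r pin by (intro SUP_cong) auto
  also have "\<dots> = \<Union> ((\<lambda>i. F i i) ` p ` {1..d})"
    by (simp only: image_image)
  finally have rP: "rng G ` ?P = ?U"
    by (simp only: permutes_image [OF p])
  have U: "compact_open (gtop G) ?U" "?U \<subseteq> units G"
    using compact_open_src [OF P] sP by auto
  have "bisection G (?P \<union> (units G - ?U))"
    using U P sP rP src_image_units [of "units G - ?U"] rng_image_units [of "units G - ?U"]
    by (intro bisection_Un bisection_units_Diff) auto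
  moreover have "src G ` (?P \<union> (units G - ?U)) = units G" "rng G ` (?P \<union> (units G - ?U)) = units G"
    using U sP rP src_image_units [of "units G - ?U"] rng_image_units [of "units G - ?U"]
    by (auto simp: image_Un)
  ultimately show ?thesis
    by (simp add: mem_full_group multisection_perm_def)
qed

text \<open>F_ij leads from F_ii to F_jj, so \<open>F i (q i)\<close> followed by
  \<open>F (q i) (p (q i))\<close> realises \<open>p\<close> after \<open>q\<close>: the assignment
  is a homomorphism, without reversal of order.\<close>

lemma multisection_perm_comp:
  assumes M: "multisection G d F" and p: "p permutes {1..d}" and q: "q permutes {1..d}"
  shows "multisection_perm G d F (p \<circ> q) = setcomp G (multisection_perm G d F p) (multisection_perm G d F q)"
proof (rule full_group_eqI)
  show "multisection_perm G d F (p \<circ> q) \<in> carrier (full_group G)"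
    using M p q by (intro multisection_perm_in_full_group permutes_compose)
  show "setcomp G (multisection_perm G d F p) (multisection_perm G d F q) \<in> carrier (full_group G)"
    using full.m_closed [OF multisection_perm_in_full_group [OF M p] multisection_perm_in_full_group [OF M q]]
    by simp
  show "multisection_perm G d F (p \<circ> q) \<subseteq> setcomp G (multisection_perm G d F p) (multisection_perm G d F q)"
  proof
    fix x assume "x \<in> multisection_perm G d F (p \<circ> q)"
    then consider i where "i \<in> {1..d}" "x \<in> F i (p (q i))"
      | "x \<in> units G" "x \<notin> (\<Union>i\<in>{1..d}. F i i)"
      by (auto simp: multisection_perm_def)
    then show "x \<in> setcomp G (multisection_perm G d F p) (multisection_perm G d F q)"
    proof cases
      case 1
      then have q1: "q i \<in> {1..d}" "p (q i) \<in> {1..d}"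
        using p q by (meson permutes_in_image)+
      then have "x \<in> setcomp G (F (q i) (p (q i))) (F i (q i))"
        using 1 M multisection_comp by simp
      then show ?thesis
        using 1 q1 unfolding setcomp_iff multisection_perm_def by blast
    next
      case 2
      then have "gcomp G x x \<in> setcomp G (multisection_perm G d F p) (multisection_perm G d F q)"
        by (intro setcompI) (auto simp: multisection_perm_def unit_in_arrows src_unit rng_unit)
      then show ?thesis
        using 2 by (simp add: comp_unit_right unit_in_arrows src_unit)
    qed
  qed
qed

lemma multisection_perm_id:
  assumes "multisection G d F"
  shows "multisection_perm G d F id = units G"
proof -
  have "(\<Union>i\<in>{1..d}. F i i) \<subseteq> units G"
    using multisection_units [OF assms] by blast
  then show ?thesis
    by (auto simp: multisection_perm_def)
qed

text \<open>Exactly the bisections over which \<open>induced_by_tau\<close> quantifies.\<close>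

definition displacing :: "'a set \<Rightarrow> bool" where
  "displacing F \<longleftrightarrow> bisection G F \<and> src G ` F \<inter> rng G ` F = {}"

lemma tau_in_full_group:
  assumes "displacing F"
  shows "tau G F \<in> carrier (full_group G)"
proof -
  have F: "bisection G F" "src G ` F \<inter> rng G ` F = {}" and sub: "F \<subseteq> arrows G"
    using assms bisection_subset_arrows by (auto simp: displacing_def)
  let ?P = "F \<union> ginv G ` F" and ?U = "src G ` F \<union> rng G ` F"
  have P: "bisection G ?P"
    using F sub by (intro bisection_Un bisection_inv) (simp_all add: src_image_inv rng_image_inv Int_commute)
  have sP: "src G ` ?P = ?U" "rng G ` ?P = ?U"
    using sub by (auto simp: image_Un src_image_inv rng_image_inv)
  have U: "compact_open (gtop G) ?U" "?U \<subseteq> units G"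
    using compact_open_src [OF P] sP by auto
  have "bisection G (?P \<union> (units G - ?U))"
    using U P sP src_image_units [of "units G - ?U"] rng_image_units [of "units G - ?U"]
    by (intro bisection_Un [OF P bisection_units_Diff [OF U]]) auto
  moreover have "src G ` (?P \<union> (units G - ?U)) = units G" "rng G ` (?P \<union> (units G - ?U)) = units G"
    using U sP src_image_units [of "units G - ?U"] rng_image_units [of "units G - ?U"]
    by (auto simp: image_Un)
  ultimately show ?thesis
    by (simp add: mem_full_group tau_def)
qed

lemma displacing_multisection:
  assumes "multisection G d F" "i \<in> {1..d}" "j \<in> {1..d}" "i \<noteq> j"
  shows "displacing (F i j)"
  using assms multisection_bisection multisection_src multisection_rng multisection_disjoint
  by (simp add: displacing_def)

text \<open>F_ji is the inverse of F_ij and supplies the other half of the involution; every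
  remaining F_kk consists of units off the source and range of F_ij.\<close>

lemma multisection_perm_transpose:
  assumes M: "multisection G d F" and ij: "i \<in> {1..d}" "j \<in> {1..d}" "i \<noteq> j"
  shows "multisection_perm G d F (Transposition.transpose i j) = tau G (F i j)"
proof (rule full_group_eqI)
  show "multisection_perm G d F (Transposition.transpose i j) \<in> carrier (full_group G)"
    using ij by (intro multisection_perm_in_full_group [OF M] permutes_swap_id)
  show "tau G (F i j) \<in> carrier (full_group G)"
    using assms by (intro tau_in_full_group displacing_multisection)
  show "multisection_perm G d F (Transposition.transpose i j) \<subseteq> tau G (F i j)"
  proof
    fix x assume "x \<in> multisection_perm G d F (Transposition.transpose i j)"
    then consider k where "k \<in> {1..d}" "x \<in> F k (Transposition.transpose i j k)"
      | "x \<in> units G" "x \<notin> (\<Union>i\<in>{1..d}. F i i)"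
      by (auto simp: multisection_perm_def)
    then show "x \<in> tau G (F i j)"
    proof cases
      case 1
      consider "k = i" | "k = j" | "k \<noteq> i" "k \<noteq> j" by blast
      then show ?thesis
      proof cases
        case 1
        with \<open>x \<in> F k (Transposition.transpose i j k)\<close> show ?thesis by (simp add: tau_def)
      next
        case 2
        with \<open>x \<in> F k (Transposition.transpose i j k)\<close> show ?thesis
          using multisection_inv [OF M ij(1,2)] by (simp add: tau_def)
      next
        case 3
        with \<open>x \<in> F k (Transposition.transpose i j k)\<close> \<open>k \<in> {1..d}\<close> show ?thesis
          using multisection_src [OF M ij(1,2)] multisection_rng [OF M ij(1,2)]
            multisection_disjoint [OF M \<open>k \<in> {1..d}\<close> ij(1)] multisection_disjoint [OF M \<open>k \<in> {1..d}\<close> ij(2)]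
            multisection_units [OF M \<open>k \<in> {1..d}\<close>]
          by (auto simp: tau_def Transposition.transpose_def)
      qed
    next
      case 2
      then show ?thesis
        using multisection_src [OF M ij(1,2)] multisection_rng [OF M ij(1,2)] ij by (auto simp: tau_def)
    qed
  qed
qed

lemma setcomp_src_image:
  assumes "F \<subseteq> arrows G"
  shows "setcomp G F (src G ` F) = F"
proof (intro equalityI subsetI)
  fix x assume "x \<in> setcomp G F (src G ` F)"
  then show "x \<in> F"
    using assms by (auto simp: setcomp_iff rng_src comp_src subset_iff) (metis comp_src)
next
  fix x assume "x \<in> F"
  then show "x \<in> setcomp G F (src G ` F)"
    using assms setcompI [of x F "src G x" "src G ` F"]
    by (auto simp: src_in_arrows rng_src comp_src subset_iff)
qed

text \<open>Legs \<open>L i\<close> that leave a common base \<open>U\<close> for disjoint ranges: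
  L_j L_i^{-1} goes back along one leg and out along another, and in a composite the inner factor
  L_j^{-1} L_j = U cancels.\<close>

lemma multisection_of_bisections:
  assumes L: "\<And>i. i \<in> {1..d} \<Longrightarrow> bisection G (L i)" and U: "\<And>i. i \<in> {1..d} \<Longrightarrow> src G ` L i = U"
    and dj: "\<And>i j. i \<in> {1..d} \<Longrightarrow> j \<in> {1..d} \<Longrightarrow> i \<noteq> j \<Longrightarrow> rng G ` L i \<inter> rng G ` L j = {}"
  shows "multisection G d (\<lambda>i j. setcomp G (L j) (ginv G ` L i))"
  unfolding multisection_def
proof (intro conjI ballI impI)
  fix i j assume i: "i \<in> {1..d}" and j: "j \<in> {1..d}"
  show "bisection G (setcomp G (L j) (ginv G ` L i))"
    using L i j bisection_setcomp bisection_inv by blast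
  fix k assume k: "k \<in> {1..d}"
  have "setcomp G (setcomp G (L k) (ginv G ` L j)) (setcomp G (L j) (ginv G ` L i))
      = setcomp G (setcomp G (L k) (setcomp G (ginv G ` L j) (L j))) (ginv G ` L i)"
    by (simp add: setcomp_assoc)
  also have "setcomp G (L k) (setcomp G (ginv G ` L j) (L j)) = L k"
    using inv_image_setcomp(1) [OF L [OF j]] U [OF j] U [OF k]
      setcomp_src_image [OF bisection_subset_arrows [OF L [OF k]]] by simp
  finally show "setcomp G (setcomp G (L k) (ginv G ` L j)) (setcomp G (L j) (ginv G ` L i))
      = setcomp G (L k) (ginv G ` L i)" .
next
  fix i assume i: "i \<in> {1..d}"
  show "setcomp G (L i) (ginv G ` L i) \<subseteq> units G"
    using inv_image_setcomp(2) [OF L [OF i]] compact_open_rng(2) [OF L [OF i]] by simp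
  fix j assume j: "j \<in> {1..d}" and "i \<noteq> j"
  then show "setcomp G (L i) (ginv G ` L i) \<inter> setcomp G (L j) (ginv G ` L j) = {}"
    using inv_image_setcomp(2) L i j dj by simp
qed

text \<open>The conjugate g F g^{-1}, formed with products of sets because \<open>F\<close> need not
  belong to the full group, where conjugation would otherwise take place.\<close>

definition conj_bisection :: "'a set \<Rightarrow> 'a set \<Rightarrow> 'a set" where
  "conj_bisection g F = setcomp G (setcomp G g F) (ginv G ` g)"

lemma conj_bisection_iff:
  assumes g: "g \<subseteq> arrows G" and F: "F \<subseteq> arrows G"
  shows "x \<in> conj_bisection g F \<longleftrightarrow> (\<exists>a b c. a \<in> g \<and> b \<in> F \<and> c \<in> g \<and> src G a = rng G b \<and> src G b = src G c
    \<and> x = gcomp G (gcomp G a b) (ginv G c))"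
proof
  assume "x \<in> conj_bisection g F"
  then obtain a b c where "a \<in> g" "b \<in> F" "c \<in> g" "src G a = rng G b"
      "src G (gcomp G a b) = rng G (ginv G c)" "x = gcomp G (gcomp G a b) (ginv G c)"
    by (auto simp: conj_bisection_def setcomp_iff)
  then show "\<exists>a b c. a \<in> g \<and> b \<in> F \<and> c \<in> g \<and> src G a = rng G b \<and> src G b = src G c
      \<and> x = gcomp G (gcomp G a b) (ginv G c)"
    using g F by (metis rng_inv src_of_comp subsetD)
next
  assume "\<exists>a b c. a \<in> g \<and> b \<in> F \<and> c \<in> g \<and> src G a = rng G b \<and> src G b = src G c
      \<and> x = gcomp G (gcomp G a b) (ginv G c)"
  then show "x \<in> conj_bisection g F"
    using g F unfolding conj_bisection_def
    by (elim exE conjE, simp) (intro setcompI, auto simp: groupoid_simps subset_iff)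
qed

text \<open>On sets of units, conjugation is the action of the homeomorphism of the unit space that
  sends s(a) to r(a) for a in \<open>g\<close>.\<close>

lemma conj_bisection_unit:
  assumes g: "g \<in> carrier (full_group G)" and V: "V \<subseteq> units G"
  shows "conj_bisection g V = {rng G a | a. a \<in> g \<and> src G a \<in> V}"
proof -
  have sub: "g \<subseteq> arrows G"
    using g full_group_subset_arrows by blast
  have inj: "a = c" if "a \<in> g" "c \<in> g" "src G a = src G c" for a c
    using g that bisection_inj_src inj_onD mem_full_group by metis
  show ?thesis
  proof (intro equalityI subsetI)
    fix x assume "x \<in> conj_bisection g V"
    then obtain a b c where h: "a \<in> g" "b \<in> V" "c \<in> g" "src G a = rng G b" "src G b = src G c"
      "x = gcomp G (gcomp G a b) (ginv G c)"
      using conj_bisection_iff [OF sub order_trans [OF V units_subset_arrows]] by blast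
    then have "a = c" "src G a = b"
      using V inj [of a c] by (auto simp: src_unit rng_unit subset_iff)
    then have "x = rng G a"
      using h sub by (auto simp: comp_src gcomp_inv)
    then show "x \<in> {rng G a | a. a \<in> g \<and> src G a \<in> V}"
      using h \<open>src G a = b\<close> by blast
  next
    fix x assume "x \<in> {rng G a | a. a \<in> g \<and> src G a \<in> V}"
    then obtain a where a: "a \<in> g" "src G a \<in> V" "x = rng G a"
      by blast
    then have "a \<in> arrows G"
      using sub by blast
    then show "x \<in> conj_bisection g V"
      unfolding conj_bisection_iff [OF sub order_trans [OF V units_subset_arrows]] using a
      by (intro exI [of _ a] exI [of _ "src G a"]) (simp add: src_src rng_src comp_src gcomp_inv)
  qed
qed

lemma conj_bisection_comp:
  assumes "g \<in> carrier (full_group G)" "A \<subseteq> arrows G" "B \<subseteq> arrows G"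
  shows "setcomp G (conj_bisection g A) (conj_bisection g B) = conj_bisection g (setcomp G A B)"
proof -
  have "setcomp G (conj_bisection g A) (conj_bisection g B)
      = setcomp G (setcomp G g (setcomp G A (setcomp G (setcomp G (ginv G ` g) g) B))) (ginv G ` g)"
    by (simp add: conj_bisection_def setcomp_assoc)
  also have "setcomp G (ginv G ` g) g = units G"
    using assms(1) inv_image_setcomp by (simp add: mem_full_group)
  finally show ?thesis
    using assms by (simp add: conj_bisection_def setcomp_units_left setcomp_assoc)
qed

lemma bisection_conj_bisection:
  "g \<in> carrier (full_group G) \<Longrightarrow> bisection G F \<Longrightarrow> bisection G (conj_bisection g F)"
  by (simp add: conj_bisection_def bisection_setcomp bisection_inv mem_full_group)

text \<open>With \<open>multisection_perm_conj\<close>, this shows that the generators of the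
  alternating group are permuted by conjugation in the full group.\<close>

lemma multisection_conj:
  assumes g: "g \<in> carrier (full_group G)" and M: "multisection G d F"
  shows "multisection G d (\<lambda>i j. conj_bisection g (F i j))"
  unfolding multisection_def
proof (intro conjI ballI impI)
  fix i j assume i: "i \<in> {1..d}" and j: "j \<in> {1..d}"
  show "bisection G (conj_bisection g (F i j))"
    using g bisection_conj_bisection multisection_bisection [OF M i j] by blast
  fix k assume k: "k \<in> {1..d}"
  show "setcomp G (conj_bisection g (F j k)) (conj_bisection g (F i j)) = conj_bisection g (F i k)"
    using conj_bisection_comp [OF g] multisection_comp [OF M i j k] multisection_bisection [OF M] i j k
    by (simp add: bisection_subset_arrows)
next
  fix i assume i: "i \<in> {1..d}"
  show "conj_bisection g (F i i) \<subseteq> units G"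
    unfolding conj_bisection_unit [OF g multisection_units [OF M i]]
    using full_group_subset_arrows [OF g] by (auto simp: rng_in_units)
  fix j assume j: "j \<in> {1..d}" and "i \<noteq> j"
  then show "conj_bisection g (F i i) \<inter> conj_bisection g (F j j) = {}"
    unfolding conj_bisection_unit [OF g multisection_units [OF M i]]
      conj_bisection_unit [OF g multisection_units [OF M j]]
    using g multisection_disjoint [OF M i j] inj_onD [OF bisection_inj_rng, of g]
    by (auto simp: mem_full_group)
qed

lemma multisection_perm_conj:
  assumes g: "g \<in> carrier (full_group G)" and M: "multisection G d F" and p: "p permutes {1..d}"
  shows "multisection_perm G d (\<lambda>i j. conj_bisection g (F i j)) p = conj_bisection g (multisection_perm G d F p)"
proof (rule full_group_eqI)
  let ?M = "\<lambda>i j. conj_bisection g (F i j)"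
  have sub: "g \<subseteq> arrows G"
    using g full_group_subset_arrows by blast
  have psub: "multisection_perm G d F p \<subseteq> arrows G"
    using multisection_perm_in_full_group [OF M p] full_group_subset_arrows by blast
  show "multisection_perm G d ?M p \<in> carrier (full_group G)"
    by (rule multisection_perm_in_full_group [OF multisection_conj [OF g M] p])
  show "conj_bisection g (multisection_perm G d F p) \<in> carrier (full_group G)"
    using full.m_closed [OF full.m_closed [OF g multisection_perm_in_full_group [OF M p]] ginv_image_full_group [OF g]]
    by (simp add: conj_bisection_def)
  show "multisection_perm G d ?M p \<subseteq> conj_bisection g (multisection_perm G d F p)"
  proof
    fix x assume "x \<in> multisection_perm G d ?M p"
    then consider k where "k \<in> {1..d}" "x \<in> conj_bisection g (F k (p k))"
      | "x \<in> units G" "x \<notin> (\<Union>i\<in>{1..d}. conj_bisection g (F i i))"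
      by (auto simp: multisection_perm_def)
    then show "x \<in> conj_bisection g (multisection_perm G d F p)"
    proof cases
      case 1
      then have "F k (p k) \<subseteq> multisection_perm G d F p"
        by (auto simp: multisection_perm_def)
      then show ?thesis
        using 1 unfolding conj_bisection_def setcomp_iff by blast
    next
      case 2
      then obtain a where a: "a \<in> g" "x = rng G a"
        using g unfolding mem_full_group by blast
      then have aa: "a \<in> arrows G"
        using sub by blast
      have "src G a \<notin> F i i" if "i \<in> {1..d}" for i
        using 2(2) a that conj_bisection_unit [OF g multisection_units [OF M that]] by blast
      then have "src G a \<in> multisection_perm G d F p"
        using aa by (auto simp: multisection_perm_def src_in_units)
      then show ?thesis
        unfolding conj_bisection_iff [OF sub psub] using a aa
        by (intro exI [of _ a] exI [of _ "src G a"]) (simp add: src_src rng_src comp_src gcomp_inv)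
    qed
  qed
qed

end

section \<open>Classes of involutions modulo the alternating group\<close>

context compact_etale_groupoid begin

text \<open>The product F V for a set \<open>V\<close> of units, written as a condition on sources
  so that unions, inclusions and disjointness in \<open>V\<close> pass to \<open>restr F V\<close>
  by set algebra.\<close>

definition restr :: "'a set \<Rightarrow> 'a set \<Rightarrow> 'a set" where
  "restr F V = {f \<in> F. src G f \<in> V}"

lemma restr_empty [simp]: "restr F {} = {}"
  and restr_Un: "restr F (V \<union> W) = restr F V \<union> restr F W"
  and restr_disjoint: "V \<inter> W = {} \<Longrightarrow> restr F V \<inter> restr F W = {}"
  and restr_subset: "restr F V \<subseteq> F"
  and restr_mono: "V \<subseteq> W \<Longrightarrow> restr F V \<subseteq> restr F W"
  and restr_src: "restr F (src G ` F) = F"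
  by (auto simp: restr_def)

lemma src_image_restr: "V \<subseteq> src G ` F \<Longrightarrow> src G ` restr F V = V"
  by (auto simp: restr_def)

lemma bisection_restr:
  assumes F: "bisection G F" and V: "compact_open (gtop G) V" "V \<subseteq> units G"
  shows "bisection G (restr F V)"
proof -
  have "restr F V = setcomp G F V"
  proof (intro equalityI subsetI)
    fix x assume "x \<in> restr F V"
    then have x: "x \<in> F" "src G x \<in> V" "x \<in> arrows G"
      using bisection_subset_arrows [OF F] by (auto simp: restr_def)
    then have "gcomp G x (src G x) \<in> setcomp G F V"
      by (intro setcompI) (simp_all add: src_in_arrows rng_src)
    then show "x \<in> setcomp G F V"
      using x by (simp add: comp_src)
  next
    fix x assume "x \<in> setcomp G F V"
    then show "x \<in> restr F V"
      using V(2) by (auto simp: setcomp_iff restr_def comp_unit_right rng_unit subset_iff)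
  qed
  then show ?thesis
    using F V bisection_setcomp compact_open_imp_bisection by simp
qed

lemma displacing_subset:
  assumes "displacing F" "bisection G H" "H \<subseteq> F"
  shows "displacing H"
  using assms unfolding displacing_def by blast

lemma displacing_restr:
  assumes "displacing F" "compact_open (gtop G) V" "V \<subseteq> units G"
  shows "displacing (restr F V)"
  using assms bisection_restr restr_subset displacing_subset by (metis displacing_def)

lemma displacing_inv: "displacing F \<Longrightarrow> displacing (ginv G ` F)"
  using bisection_inv src_image_inv rng_image_inv bisection_subset_arrows
  by (auto simp: displacing_def)

lemma displacing_subset_arrows: "displacing F \<Longrightarrow> F \<subseteq> arrows G"
  using bisection_subset_arrows by (auto simp: displacing_def)

text \<open>This symmetry lets every statement about sources be read as one about ranges.\<close>

lemma tau_inv: "displacing F \<Longrightarrow> tau G (ginv G ` F) = tau G F"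
  using displacing_subset_arrows [of F] inv_image_inv_image [of F]
  by (auto simp: tau_def src_image_inv rng_image_inv)

lemma tau_square:
  assumes "displacing F"
  shows "setcomp G (tau G F) (tau G F) = units G"
proof (rule full_group_eqI [symmetric])
  show "units G \<in> carrier (full_group G)"
    using full.one_closed by simp
  show "setcomp G (tau G F) (tau G F) \<in> carrier (full_group G)"
    using full.m_closed tau_in_full_group [OF assms] by fastforce
  show "units G \<subseteq> setcomp G (tau G F) (tau G F)"
  proof
    fix u assume u: "u \<in> units G"
    have sub: "F \<subseteq> arrows G"
      using assms by (rule displacing_subset_arrows)
    consider f where "f \<in> F" "u = src G f" | f where "f \<in> F" "u = rng G f"
      | "u \<notin> src G ` F \<union> rng G ` F"
      by blast
    then show "u \<in> setcomp G (tau G F) (tau G F)"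
    proof cases
      case 1
      then have "gcomp G (ginv G f) f \<in> setcomp G (tau G F) (tau G F)"
        using sub by (intro setcompI) (auto simp: tau_def inv_closed src_inv)
      then show ?thesis using 1 by (simp add: gcomp_inv_left)
    next
      case 2
      then have "gcomp G f (ginv G f) \<in> setcomp G (tau G F) (tau G F)"
        using sub by (intro setcompI) (auto simp: tau_def inv_closed rng_inv)
      then show ?thesis using 2 by (simp add: gcomp_inv)
    next
      case 3
      then have "gcomp G u u \<in> setcomp G (tau G F) (tau G F)"
        using u by (intro setcompI) (auto simp: tau_def unit_in_arrows src_unit rng_unit)
      then show ?thesis using u by (simp add: comp_unit_right unit_in_arrows src_unit)
    qed
  qed
qed

text \<open>Injectivity on the union makes s(F), s(H), r(F), r(H) pairwise disjoint, so the two
  involutions have disjoint supports.\<close>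

lemma tau_Un:
  assumes FH: "displacing (F \<union> H)" and F: "displacing F" and H: "displacing H" and dj: "F \<inter> H = {}"
  shows "tau G (F \<union> H) = setcomp G (tau G F) (tau G H)"
proof (rule full_group_eqI)
  have sub: "F \<subseteq> arrows G" "H \<subseteq> arrows G"
    using F H displacing_subset_arrows by auto
  have s: "src G ` F \<inter> src G ` H = {}" and r: "rng G ` F \<inter> rng G ` H = {}"
    and sr: "src G ` (F \<union> H) \<inter> rng G ` (F \<union> H) = {}"
    using FH dj bisection_inj_src [of "F \<union> H"] bisection_inj_rng [of "F \<union> H"]
    by (auto simp: displacing_def dest: inj_onD)
  show "tau G (F \<union> H) \<in> carrier (full_group G)"
    using FH by (rule tau_in_full_group)
  show "setcomp G (tau G F) (tau G H) \<in> carrier (full_group G)"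
    using full.m_closed tau_in_full_group F H by fastforce
  \<comment> \<open>An arrow of one involution is multiplied by a unit that the other involution
    fixes: on its source side here, on its range side in \<open>left\<close>.\<close>
  have right: "f \<in> setcomp G (tau G F) (tau G H)"
    if "f \<in> tau G F" "f \<in> arrows G" "src G f \<notin> src G ` H \<union> rng G ` H" for f
  proof -
    have "gcomp G f (src G f) \<in> setcomp G (tau G F) (tau G H)"
      using that by (intro setcompI) (auto simp: tau_def src_in_arrows rng_src src_in_units)
    then show ?thesis
      using that by (simp add: comp_src)
  qed
  have left: "f \<in> setcomp G (tau G F) (tau G H)"
    if "f \<in> tau G H" "f \<in> arrows G" "rng G f \<notin> src G ` F \<union> rng G ` F" for f
  proof -
    have "gcomp G (rng G f) f \<in> setcomp G (tau G F) (tau G H)"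
      using that by (intro setcompI) (auto simp: tau_def rng_in_arrows src_rng rng_in_units)
    then show ?thesis
      using that by (simp add: rng_comp_left)
  qed
  show "tau G (F \<union> H) \<subseteq> setcomp G (tau G F) (tau G H)"
  proof
    fix x assume "x \<in> tau G (F \<union> H)"
    then consider "x \<in> F" | "x \<in> H" | f where "f \<in> F" "x = ginv G f" | f where "f \<in> H" "x = ginv G f"
      | "x \<in> units G" "x \<notin> src G ` (F \<union> H) \<union> rng G ` (F \<union> H)"
      by (auto simp: tau_def)
    then show "x \<in> setcomp G (tau G F) (tau G H)"
    proof cases
      case 1
      then show ?thesis
        using sub s sr by (intro right) (auto simp: tau_def)
    next
      case 2
      then show ?thesis
        using sub r sr by (intro left) (auto simp: tau_def)
    next
      case 3
      then have "src G x = rng G f" "x \<in> arrows G"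
        using sub by (auto simp: src_inv inv_closed)
      then show ?thesis
        using 3 r sr by (intro right) (auto simp: tau_def)
    next
      case 4
      then have "rng G x = src G f" "x \<in> arrows G"
        using sub by (auto simp: rng_inv inv_closed)
      then show ?thesis
        using 4 s sr by (intro left) (auto simp: tau_def)
    next
      case 5
      then show ?thesis
        by (intro right) (auto simp: tau_def unit_in_arrows src_unit)
    qed
  qed
qed

section \<open>Generators of the symmetric and alternating groups\<close>

lemma carrier_A_group:
  "carrier (A_group G) = generate (full_group G) (\<Union>{A_multisection G 3 F | F. multisection G 3 F})"
proof -
  have "\<Union>{A_multisection G 3 F | F. multisection G 3 F} \<subseteq> carrier (full_group G)"
    using multisection_perm_in_full_group by (auto simp: A_multisection_def)
  then show ?thesis
    by (simp add: A_group_def carrier_subgroup_generated inf.absorb2)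
qed

text \<open>The two legs are the unit bisection on s(F) and \<open>F\<close> itself; displacement
  says that their ranges are disjoint.\<close>

lemma source_multisection:
  assumes "displacing F"
  obtains M where "multisection G 2 M" "M 1 2 = F"
proof -
  define M where "M i j = setcomp G (if j = 1 then src G ` F else F) (ginv G ` (if i = 1 then src G ` F else F))"
    for i j :: nat
  have F: "bisection G F" "src G ` F \<inter> rng G ` F = {}"
    using assms by (auto simp: displacing_def)
  note U = compact_open_src [OF F(1)]
  have bU: "bisection G (src G ` F)"
    by (rule compact_open_imp_bisection [OF U])
  have "multisection G 2 M"
    unfolding M_def using bU F src_image_units [OF U(2)] rng_image_units [OF U(2)]
    by (intro multisection_of_bisections [where U = "src G ` F"]) auto
  moreover have "ginv G ` src G ` F = src G ` F"
    using U(2) inv_unit by (force simp: subset_iff)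
  then have "M 1 2 = F"
    using setcomp_src_image bisection_subset_arrows [OF F(1)] by (simp add: M_def)
  ultimately show thesis ..
qed

text \<open>In degree 2 the only permutations are the identity and the swap, and each displacing
  bisection is the off-diagonal entry of some multisection. The involutions therefore
  generate.\<close>

lemma carrier_S_group: "carrier (S_group G) = generate (full_group G) {tau G F | F. displacing F}"
proof -
  let ?X = "\<Union>{S_multisection G 2 F | F. multisection G 2 F}" and ?Y = "{tau G F | F. displacing F}"
  have X: "?X \<subseteq> carrier (full_group G)"
    using multisection_perm_in_full_group by (auto simp: S_multisection_def)
  have Y: "?Y \<subseteq> carrier (full_group G)"
    using tau_in_full_group by auto
  have two: "{1..2} = {1, 2::nat}"
    by auto
  have "?X \<subseteq> generate (full_group G) ?Y"
  proof
    fix x assume "x \<in> ?X"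
    then obtain F p where M: "multisection G 2 F" and p: "p permutes {1..2}" and x: "x = multisection_perm G 2 F p"
      by (auto simp: S_multisection_def)
    consider "p = id" | "p = Transposition.transpose 1 2"
      using p permutes_doubleton_iff [of p 1 2] unfolding two by blast
    then show "x \<in> generate (full_group G) ?Y"
    proof cases
      case 1
      then show ?thesis
        using x multisection_perm_id [OF M] generate.one [of "full_group G"] by simp
    next
      case 2
      then show ?thesis
        using x multisection_perm_transpose [OF M, of 1 2] displacing_multisection [OF M, of 1 2]
        by (auto intro!: generate.incl)
    qed
  qed
  moreover have "?Y \<subseteq> generate (full_group G) ?X"
  proof
    fix x assume "x \<in> ?Y"
    then obtain F where F: "displacing F" "x = tau G F"
      by auto
    obtain M where M: "multisection G 2 M" "M 1 2 = F"
      using source_multisection [OF F(1)] by blast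
    then have "x = multisection_perm G 2 M (Transposition.transpose 1 2)"
      using multisection_perm_transpose [OF M(1), of 1 2] F by simp
    moreover have "Transposition.transpose 1 2 permutes {1..2::nat}"
      by (rule permutes_swap_id) auto
    ultimately show "x \<in> generate (full_group G) ?X"
      using M(1) by (intro generate.incl) (auto simp: S_multisection_def)
  qed
  ultimately have "generate (full_group G) ?X = generate (full_group G) ?Y"
    using full.generate_subgroup_incl full.generate_is_subgroup X Y by (meson subset_antisym)
  then show ?thesis
    using X by (simp add: S_group_def carrier_subgroup_generated inf.absorb2)
qed

lemma mult_S_group [simp]: "monoid.mult (S_group G) = setcomp G"
  and one_S_group [simp]: "one (S_group G) = units G"
  by (simp_all add: S_group_def)

lemma subgroup_S_group: "subgroup (carrier (S_group G)) (full_group G)"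
  unfolding S_group_def by (rule full.subgroup_subgroup_generated)

sublocale S: group "S_group G"
  unfolding S_group_def by (rule full.group_subgroup_generated)

lemma S_group_in_full_group: "x \<in> carrier (S_group G) \<Longrightarrow> x \<in> carrier (full_group G)"
  using subgroup.mem_carrier [OF subgroup_S_group] .

lemma tau_in_S_group: "displacing F \<Longrightarrow> tau G F \<in> carrier (S_group G)"
  unfolding carrier_S_group by (auto intro: generate.incl)

text \<open>Permutations are products of transpositions, each of which gives an involution. In
  degree 3 this places the alternating group inside the symmetric one.\<close>

lemma multisection_perm_in_S_group:
  assumes M: "multisection G d F" and p: "p permutes {1..d}"
  shows "multisection_perm G d F p \<in> carrier (S_group G)"
  using p finite_atLeastAtMost
proof (induction rule: permutes_induct)
  case id
  then show ?case
    unfolding multisection_perm_id [OF M] using S.one_closed by simp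
next
  case (swap a b p)
  then have eq: "multisection_perm G d F (Transposition.transpose a b \<circ> p)
      = setcomp G (tau G (F a b)) (multisection_perm G d F p)"
    using multisection_perm_comp [OF M permutes_swap_id] multisection_perm_transpose [OF M] by simp
  then show ?case
    unfolding eq
    using S.m_closed [OF tau_in_S_group [OF displacing_multisection [OF M swap.hyps(1-3)]] swap.IH] by simp
qed

text \<open>Conjugation by the full group permutes the generators, so normality holds there first
  and then restricts to the symmetric group.\<close>

lemma A_group_normal: "carrier (A_group G) \<lhd> S_group G"
proof -
  let ?X = "\<Union>{A_multisection G 3 F | F. multisection G 3 F}"
  have X: "?X \<subseteq> carrier (full_group G)"
    using multisection_perm_in_full_group by (auto simp: A_multisection_def)
  have "generate (full_group G) ?X \<lhd> full_group G"
  proof (rule full.normal_generateI [OF X])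
    fix h g assume h: "h \<in> ?X" and g: "g \<in> carrier (full_group G)"
    then obtain F p where M: "multisection G 3 F" and p: "p permutes {1..3}" "evenperm p"
      and x: "h = multisection_perm G 3 F p"
      by (auto simp: A_multisection_def)
    then have "g \<otimes>\<^bsub>full_group G\<^esub> h \<otimes>\<^bsub>full_group G\<^esub> inv\<^bsub>full_group G\<^esub> g
        = multisection_perm G 3 (\<lambda>i j. conj_bisection g (F i j)) p"
      using multisection_perm_conj [OF g M p(1)] g by (simp add: inv_full_group conj_bisection_def)
    then show "g \<otimes>\<^bsub>full_group G\<^esub> h \<otimes>\<^bsub>full_group G\<^esub> inv\<^bsub>full_group G\<^esub> g \<in> ?X"
      using multisection_conj [OF g M] p by (auto simp: A_multisection_def)
  qed
  then have N: "carrier (A_group G) \<lhd> full_group G"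
    by (simp add: carrier_A_group)
  have "?X \<subseteq> carrier (S_group G)"
    using multisection_perm_in_S_group by (auto simp: A_multisection_def)
  then have sub: "carrier (A_group G) \<subseteq> carrier (S_group G)"
    unfolding carrier_A_group by (rule full.generate_subgroup_incl [OF _ subgroup_S_group])
  have "subgroup (carrier (A_group G)) (S_group G)"
    using N sub unfolding S_group_def full.subgroup_subgroup_generated_iff
    by (simp add: normal_imp_subgroup)
  moreover have "x \<otimes>\<^bsub>S_group G\<^esub> h \<otimes>\<^bsub>S_group G\<^esub> inv\<^bsub>S_group G\<^esub> x \<in> carrier (A_group G)"
    if "x \<in> carrier (S_group G)" "h \<in> carrier (A_group G)" for x h
    using that normal.inv_op_closed2 [OF N, of x h] S_group_in_full_group [of x]
      full.inv_subgroup_generated [of x] by (simp add: S_group_def)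
  ultimately show ?thesis
    unfolding S.normal_inv_iff by blast
qed

section \<open>The quotient of the symmetric by the alternating group\<close>

abbreviation quot :: "'a set set monoid" where
  "quot \<equiv> S_group G Mod carrier (A_group G)"

abbreviation cls :: "'a set \<Rightarrow> 'a set set" where
  "cls x \<equiv> carrier (A_group G) #>\<^bsub>S_group G\<^esub> x"

sublocale Q: group quot
  by (rule normal.factorgroup_is_group [OF A_group_normal])

lemma cls_closed: "x \<in> carrier (S_group G) \<Longrightarrow> cls x \<in> carrier quot"
  by (auto simp: carrier_FactGroup)

lemma cls_mult:
  "x \<in> carrier (S_group G) \<Longrightarrow> y \<in> carrier (S_group G) \<Longrightarrow> cls (setcomp G x y) = cls x \<otimes>\<^bsub>quot\<^esub> cls y"
  using hom_mult [OF normal.r_coset_hom_Mod [OF A_group_normal], of x y] by simp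

lemma cls_eq_one: "x \<in> carrier (A_group G) \<Longrightarrow> cls x = \<one>\<^bsub>quot\<^esub>"
  using S.coset_join2 [of x "carrier (A_group G)"] normal_imp_subgroup [OF A_group_normal]
    subgroup.mem_carrier by (metis one_FactGroup)

lemma cls_units: "cls (units G) = \<one>\<^bsub>quot\<^esub>"
  using cls_eq_one subgroup.one_closed [OF normal_imp_subgroup [OF A_group_normal]] by simp

lemma cls_tau_closed [simp]: "displacing F \<Longrightarrow> cls (tau G F) \<in> carrier quot"
  using cls_closed tau_in_S_group by blast

lemma cls_tau_square: "displacing F \<Longrightarrow> cls (tau G F) \<otimes>\<^bsub>quot\<^esub> cls (tau G F) = \<one>\<^bsub>quot\<^esub>"
  using cls_mult [OF tau_in_S_group tau_in_S_group] tau_square cls_units by metis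

lemma cls_tau_Un:
  "displacing (F \<union> H) \<Longrightarrow> displacing F \<Longrightarrow> displacing H \<Longrightarrow> F \<inter> H = {}
    \<Longrightarrow> cls (tau G (F \<union> H)) = cls (tau G F) \<otimes>\<^bsub>quot\<^esub> cls (tau G H)"
  using cls_mult [OF tau_in_S_group tau_in_S_group] tau_Un by metis

lemma cls_tau_eqI:
  assumes F: "displacing F" and H: "displacing H" and A: "setcomp G (tau G F) (tau G H) \<in> carrier (A_group G)"
  shows "cls (tau G F) = cls (tau G H)"
proof -
  have "cls (tau G F) \<otimes>\<^bsub>quot\<^esub> cls (tau G H) = cls (tau G H) \<otimes>\<^bsub>quot\<^esub> cls (tau G H)"
    using cls_mult [OF tau_in_S_group [OF F] tau_in_S_group [OF H]] cls_eq_one [OF A] cls_tau_square [OF H]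
    by simp
  then show ?thesis
    using F H Q.right_cancel [of "cls (tau G H)" "cls (tau G F)" "cls (tau G H)"] by simp
qed

lemma cls_tau_eq_disjoint_ranges:
  assumes F: "displacing F" and H: "displacing H" and s: "src G ` F = src G ` H"
    and r: "rng G ` F \<inter> rng G ` H = {}"
  shows "cls (tau G F) = cls (tau G H)"
proof (rule cls_tau_eqI [OF F H])
  \<comment> \<open>Three legs over s(F): the unit bisection, \<open>F\<close> and \<open>H\<close>.
    Displacement separates s(F) from both ranges, and \<open>r\<close> separates the ranges from
    each other. In the resulting multisection tau_F is (1 2) and tau_H is (1 3).\<close>
  define L where "L i = (if i = 1 then src G ` F else if i = 2 then F else H)" for i :: nat
  define M where "M i j = setcomp G (L j) (ginv G ` L i)" for i j
  have bF: "bisection G F" "src G ` F \<inter> rng G ` F = {}" and bH: "bisection G H" "src G ` H \<inter> rng G ` H = {}"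
    using F H by (auto simp: displacing_def)
  note U = compact_open_src [OF bF(1)]
  have bU: "bisection G (src G ` F)"
    by (rule compact_open_imp_bisection [OF U])
  have M: "multisection G 3 M"
    unfolding M_def using bU bF bH s r src_image_units [OF U(2)] rng_image_units [OF U(2)]
    by (intro multisection_of_bisections [where U = "src G ` F"]) (auto simp: L_def)
  have "ginv G ` src G ` F = src G ` F"
    using U(2) inv_unit by (force simp: subset_iff)
  then have "M 1 2 = F" "M 1 3 = H"
    using setcomp_src_image [OF bisection_subset_arrows [OF bF(1)]] s
      setcomp_src_image [OF bisection_subset_arrows [OF bH(1)]] by (simp_all add: M_def L_def)
  then have "tau G F = multisection_perm G 3 M (Transposition.transpose 1 2)"
    "tau G H = multisection_perm G 3 M (Transposition.transpose 1 3)"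
    using multisection_perm_transpose [OF M, of 1 2] multisection_perm_transpose [OF M, of 1 3] by simp_all
  moreover have p: "Transposition.transpose 1 2 permutes {1..3::nat}" "Transposition.transpose 1 3 permutes {1..3::nat}"
    by (auto intro!: permutes_swap_id)
  ultimately have "setcomp G (tau G F) (tau G H)
      = multisection_perm G 3 M (Transposition.transpose 1 2 \<circ> Transposition.transpose 1 3)"
    using multisection_perm_comp [OF M] by simp
  moreover have "evenperm (Transposition.transpose 1 2 \<circ> Transposition.transpose 1 (3::nat))"
    by (simp add: evenperm_comp evenperm_swap permutation_swap_id)
  ultimately show "setcomp G (tau G F) (tau G H) \<in> carrier (A_group G)"
    unfolding carrier_A_group using M permutes_compose [OF p(2,1)]
    by (intro generate.incl) (auto simp: A_multisection_def)
qed

text \<open>The unit space is Hausdorff, so two distinct range points have disjoint neighbourhoods;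
  cutting both bisections over a small common source separates their ranges.\<close>

lemma separate_ranges:
  assumes F: "bisection G F" and H: "bisection G H" and f: "f \<in> F" and h: "h \<in> H"
    and s: "src G f = src G h" and r: "rng G f \<noteq> rng G h"
  obtains W where "compact_open (gtop G) W" "src G f \<in> W" "W \<subseteq> src G ` F" "W \<subseteq> src G ` H"
    "rng G ` restr F W \<inter> rng G ` restr H W = {}"
proof -
  have "rng G f \<in> units G" "rng G h \<in> units G"
    using F H f h bisection_subset_arrows rng_in_units by blast+
  then obtain O1 O2 where O: "openin (unit_space G) O1" "openin (unit_space G) O2" "rng G f \<in> O1" "rng G h \<in> O2"
    "O1 \<inter> O2 = {}"
    using Hausdorff_units r unfolding Hausdorff_space_def disjnt_def by (metis topspace_unit_space)
  \<comment> \<open>\<open>W\<close> will be chosen inside the sources of \<open>?F\<close> and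
    \<open>?H\<close>; since the source is injective on \<open>F\<close> and on \<open>H\<close>,
    all their arrows over \<open>W\<close> then lie in \<open>?F\<close> and
    \<open>?H\<close>.\<close>
  let ?F = "{a \<in> F. rng G a \<in> O1}" and ?H = "{a \<in> H. rng G a \<in> O2}"
  have "openin (gtop G) ?F" "openin (gtop G) ?H"
    using F H O bisection_openin openin_continuous_map_preimage_gen [OF continuous_map_rng_unit_space] by blast+
  then have "openin (gtop G) (src G ` ?F \<inter> src G ` ?H)"
    using open_image_src by blast
  moreover have "src G f \<in> src G ` ?F"
    using f O by blast
  moreover have "src G f \<in> src G ` ?H"
    unfolding s using h O by blast
  ultimately obtain W where W: "bisection G W" "src G f \<in> W" "W \<subseteq> src G ` ?F \<inter> src G ` ?H"
    using bisection_basis [of "src G ` ?F \<inter> src G ` ?H" "src G f"] by blast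
  show thesis
  proof
    show "compact_open (gtop G) W"
      using W bisection_compact_open by blast
    have "rng G a \<in> O1" if "a \<in> restr F W" for a
    proof -
      have "a \<in> F" "src G a \<in> src G ` ?F"
        using that W by (auto simp: restr_def)
      then show ?thesis
        using inj_onD [OF bisection_inj_src [OF F]] by blast
    qed
    moreover have "rng G a \<in> O2" if "a \<in> restr H W" for a
    proof -
      have "a \<in> H" "src G a \<in> src G ` ?H"
        using that W by (auto simp: restr_def)
      then show ?thesis
        using inj_onD [OF bisection_inj_src [OF H]] by blast
    qed
    ultimately have "rng G ` restr F W \<subseteq> O1" "rng G ` restr H W \<subseteq> O2"
      by auto
    then show "rng G ` restr F W \<inter> rng G ` restr H W = {}"
      using O(5) by auto
    show "W \<subseteq> src G ` F" "W \<subseteq> src G ` H"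
      using W(3) by auto
  qed (rule W(2))
qed

lemma rng_restr_mono: "V \<subseteq> W \<Longrightarrow> rng G ` restr F V \<subseteq> rng G ` restr F W"
  by (intro image_mono restr_mono)

end

section \<open>Dependence on the source only\<close>

context compact_etale_groupoid begin

text \<open>Keeps products and the unit of the quotient in group form; rewritten as products of
  cosets they would be out of reach of the group laws of \<open>Q\<close>.\<close>

declare mult_FactGroup [simp del] one_FactGroup [simp del]

text \<open>There is no case for inverses because the generators are involutions.\<close>

lemma S_group_induct [consumes 1, case_names one tau mult]:
  assumes "g \<in> carrier (S_group G)"
    and one: "P (units G)"
    and tau: "\<And>F. displacing F \<Longrightarrow> P (tau G F)"
    and mult: "\<And>x y. x \<in> carrier (S_group G) \<Longrightarrow> y \<in> carrier (S_group G) \<Longrightarrow> P x \<Longrightarrow> P y \<Longrightarrow> P (setcomp G x y)"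
  shows "P g"
  using assms(1) unfolding carrier_S_group
proof (induction rule: generate.induct)
  case one
  then show ?case using assms(2) by simp
next
  case (incl h)
  then show ?case using tau by auto
next
  case (inv h)
  then obtain F where F: "displacing F" "h = tau G F"
    by auto
  then have "inv\<^bsub>full_group G\<^esub> h = h"
    using full.inv_equality [of h h] tau_square tau_in_full_group by simp
  then show ?case using F tau by simp
next
  case (eng h1 h2)
  then show ?case using mult by (simp add: carrier_S_group)
qed

lemma image_setcomp_inv:
  assumes K: "bisection G K" and B: "bisection G B" and s: "src G ` K = src G ` B"
  shows "src G ` setcomp G K (ginv G ` B) = rng G ` B" "rng G ` setcomp G K (ginv G ` B) = rng G ` K"
proof -
  have sub: "K \<subseteq> arrows G" "B \<subseteq> arrows G" "ginv G ` B \<subseteq> arrows G"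
    using K B bisection_subset_arrows inv_closed by auto
  show "src G ` setcomp G K (ginv G ` B) = rng G ` B"
    unfolding src_image_setcomp [OF sub(1,3)]
  proof (intro equalityI subsetI)
    fix x assume "x \<in> rng G ` B"
    then obtain b where "b \<in> B" "x = rng G b" by blast
    then show "x \<in> {src G b |b. b \<in> ginv G ` B \<and> rng G b \<in> src G ` K}"
      using sub s by (intro CollectI exI [of _ "ginv G b"]) (auto simp: src_inv rng_inv)
  qed (use sub in \<open>auto simp: src_inv\<close>)
  show "rng G ` setcomp G K (ginv G ` B) = rng G ` K"
    unfolding rng_image_setcomp [OF sub(1,3)] rng_image_inv [OF sub(2)] s [symmetric] by auto
qed

text \<open>\<open>F\<close> is seen as the entry \<open>M 1 2\<close> of a multisection, and the
  conjugation lemmas for multisections apply.\<close>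

lemma displacing_conj:
  assumes "displacing F" "g \<in> carrier (full_group G)"
  shows "displacing (conj_bisection g F)"
    and "tau G (conj_bisection g F) = conj_bisection g (tau G F)"
proof -
  obtain M where M: "multisection G 2 M" "M 1 2 = F"
    using source_multisection [OF assms(1)] .
  note C = multisection_conj [OF assms(2) M(1)]
  have p: "Transposition.transpose 1 2 permutes {1..2::nat}"
    by (rule permutes_swap_id) auto
  show "displacing (conj_bisection g F)"
    using displacing_multisection [OF C, of 1 2] M(2) by simp
  show "tau G (conj_bisection g F) = conj_bisection g (tau G F)"
    using multisection_perm_conj [OF assms(2) M(1) p] multisection_perm_transpose [OF M(1), of 1 2]
      multisection_perm_transpose [OF C, of 1 2] M(2) by simp
qed

end

text \<open>The infinite case is listed separately because \<open>card\<close> is 0 on infinite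
  sets.\<close>

locale large_orbit_groupoid = compact_etale_groupoid +
  assumes large_orbits: "x \<in> units G \<Longrightarrow> infinite (groupoid_orbit G x) \<or> 3 \<le> card (groupoid_orbit G x)"
begin

text \<open>The orbit point other than x and y; y will be the far end of an arrow starting at
  x.\<close>

lemma third_point:
  assumes "x \<in> units G"
  obtains k where "k \<in> arrows G" "src G k = x" "rng G k \<noteq> x" "rng G k \<noteq> y"
proof -
  have "\<not> groupoid_orbit G x \<subseteq> {x, y}"
  proof
    assume sub: "groupoid_orbit G x \<subseteq> {x, y}"
    then have "finite (groupoid_orbit G x)"
      by (rule finite_subset) simp
    moreover have "card (groupoid_orbit G x) \<le> card {x, y}"
      using sub by (intro card_mono) auto
    moreover have "card {x, y} \<le> 2"
      by (simp add: card_insert_if)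
    ultimately show False
      using large_orbits [OF assms] by auto
  qed
  then show thesis
    using that by (auto simp: groupoid_orbit_def)
qed

text \<open>Start from an arrow k at s(b) that ends neither at s(b) nor at r(b), and shrink a
  bisection around it. The resulting \<open>K\<close> is displacing and can serve as a witness in
  comparisons with \<open>B\<close>.\<close>

lemma exists_displacing:
  assumes B: "bisection G B" and b: "b \<in> B"
  obtains K where "displacing K" "src G b \<in> src G ` K" "src G ` K \<subseteq> src G ` B"
    "rng G ` K \<inter> rng G ` restr B (src G ` K) = {}"
proof -
  have ba: "b \<in> arrows G"
    using B b bisection_subset_arrows by blast
  obtain k where k: "k \<in> arrows G" "src G k = src G b" "rng G k \<noteq> src G b" "rng G k \<noteq> rng G b"
    using third_point [OF src_in_units [OF ba]] by blast
  obtain K where K: "bisection G K" "k \<in> K"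
    using bisection_basis [OF openin_topspace, of k] k by auto
  \<comment> \<open>Separating \<open>K\<close> from the unit bisection, whose range over
    \<open>V\<close> is \<open>V\<close> itself, is what makes the restriction displacing; the next
    step keeps it off the range of \<open>B\<close>.\<close>
  obtain V where V: "compact_open (gtop G) V" "src G k \<in> V" "V \<subseteq> src G ` K"
    "V \<subseteq> src G ` units G" "rng G ` restr K V \<inter> rng G ` restr (units G) V = {}"
    using separate_ranges [OF K(1) bisection_units K(2), of "src G b"] k ba
    by (auto simp: src_in_units src_src rng_src)
  obtain W where W: "compact_open (gtop G) W" "src G k \<in> W" "W \<subseteq> src G ` K"
    "W \<subseteq> src G ` B" "rng G ` restr K W \<inter> rng G ` restr B W = {}"
    using separate_ranges [OF K(1) B K(2) b] k by metis
  have Vu: "V \<subseteq> units G"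
    using V(4) src_image_units by blast
  have co: "compact_open (gtop G) (V \<inter> W)"
    using compact_open_Int [OF compact_open_units V(1) Vu W(1)] W(4) compact_open_src(2) [OF B] by blast
  have s: "src G ` restr K (V \<inter> W) = V \<inter> W"
    using V(3) by (intro src_image_restr) blast
  have "restr (units G) V = V"
    using Vu by (auto simp: restr_def src_unit subset_iff)
  then have "rng G ` restr (units G) V = V"
    using rng_image_units [OF Vu] by simp
  then have "rng G ` restr K (V \<inter> W) \<inter> (V \<inter> W) = {}"
    using V(5) rng_restr_mono [of "V \<inter> W" V K] by blast
  then have d: "displacing (restr K (V \<inter> W))"
    using bisection_restr [OF K(1) co] s Vu by (auto simp: displacing_def)
  show thesis
  proof (rule that [OF d, unfolded s])
    show "src G b \<in> V \<inter> W"
      using V W k by simp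
    show "V \<inter> W \<subseteq> src G ` B"
      using W by blast
    show "rng G ` restr K (V \<inter> W) \<inter> rng G ` restr B (V \<inter> W) = {}"
      using W(5) rng_restr_mono [of "V \<inter> W" W K] rng_restr_mono [of "V \<inter> W" W B] by blast
  qed
qed

text \<open>Over a small \<open>W\<close> the ranges are disjoint, so the 3-cycle argument applies;
  it applies equally to all smaller \<open>V\<close>, as \<open>compact_open_induct\<close>
  requires.\<close>

lemma cls_tau_eq_locally:
  assumes F: "displacing F" and H: "displacing H" and f: "f \<in> F" and h: "h \<in> H"
    and s: "src G f = src G h" and r: "rng G f \<noteq> rng G h"
  obtains W where "compact_open (gtop G) W" "src G f \<in> W" "W \<subseteq> src G ` F" "W \<subseteq> src G ` H"
    "\<And>V. compact_open (gtop G) V \<Longrightarrow> V \<subseteq> W \<Longrightarrow> cls (tau G (restr F V)) = cls (tau G (restr H V))"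
proof -
  have bF: "bisection G F" and bH: "bisection G H"
    using F H by (auto simp: displacing_def)
  obtain W where W: "compact_open (gtop G) W" "src G f \<in> W" "W \<subseteq> src G ` F" "W \<subseteq> src G ` H"
    "rng G ` restr F W \<inter> rng G ` restr H W = {}"
    using separate_ranges [OF bF bH f h s r] .
  have "cls (tau G (restr F V)) = cls (tau G (restr H V))" if V: "compact_open (gtop G) V" "V \<subseteq> W" for V
  proof (rule cls_tau_eq_disjoint_ranges)
    have "V \<subseteq> units G"
      using V W(3) compact_open_src(2) [OF bF] by blast
    then show "displacing (restr F V)" "displacing (restr H V)"
      using F H V displacing_restr by auto
    have "src G ` restr F V = V" "src G ` restr H V = V"
      using V W by (intro src_image_restr; blast)+
    then show "src G ` restr F V = src G ` restr H V"
      by simp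
    show "rng G ` restr F V \<inter> rng G ` restr H V = {}"
      using W(5) rng_restr_mono [OF V(2), of F] rng_restr_mono [OF V(2), of H] by blast
  qed
  then show thesis
    using that W by blast
qed

lemma cls_tau_restr_Un:
  assumes F: "displacing F" and V: "compact_open (gtop G) V" "V \<subseteq> units G"
    and W: "compact_open (gtop G) W" "W \<subseteq> units G" and dj: "V \<inter> W = {}"
  shows "cls (tau G (restr F (V \<union> W))) = cls (tau G (restr F V)) \<otimes>\<^bsub>quot\<^esub> cls (tau G (restr F W))"
proof -
  have "displacing (restr F V \<union> restr F W)"
  proof (rule displacing_subset [OF F])
    show "bisection G (restr F V \<union> restr F W)"
    proof (rule bisection_subset)
      show "bisection G F"
        using F by (simp add: displacing_def)
      show "compact_open (gtop G) (restr F V \<union> restr F W)"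
        using bisection_restr [OF \<open>bisection G F\<close> V] bisection_restr [OF \<open>bisection G F\<close> W]
        by (intro compact_open_subset [OF bisection_compact_open [OF \<open>bisection G F\<close>]])
          (auto simp: bisection_iff compactin_Un restr_def)
    qed (auto simp: restr_def)
  qed (auto simp: restr_def)
  then show ?thesis
    unfolding restr_Un using F V W dj
    by (intro cls_tau_Un displacing_restr restr_disjoint) auto
qed

text \<open>Both sides are additive in the part of the source to which \<open>F\<close> and
  \<open>H\<close> are restricted, so it is enough to compare them near each point x. There the
  ranges of the two arrows differ, or a detour is needed.\<close>

lemma cls_tau_eq_source:
  assumes F: "displacing F" and H: "displacing H" and s: "src G ` F = src G ` H"
  shows "cls (tau G F) = cls (tau G H)"
proof -
  have bF: "bisection G F" and bH: "bisection G H"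
    using F H by (auto simp: displacing_def)
  note U = compact_open_src [OF bF]
  have "cls (tau G (restr F (src G ` F))) = cls (tau G (restr H (src G ` F)))"
    using U(1)
  proof (induction rule: compact_open_induct)
    case empty
    then show ?case by simp
  next
    case (union V W)
    then show ?case
      using U(2) by (subst (1 2) cls_tau_restr_Un) (auto intro: F H)
  next
    case (basis x)
    then obtain f h where f: "f \<in> F" "src G f = x" and h: "h \<in> H" "src G h = x"
      using s by (metis imageE)
    show ?case
    proof (cases "rng G f = rng G h")
      case False
      obtain W where "compact_open (gtop G) W" "src G f \<in> W" "W \<subseteq> src G ` F"
        "\<And>V. compact_open (gtop G) V \<Longrightarrow> V \<subseteq> W \<Longrightarrow> cls (tau G (restr F V)) = cls (tau G (restr H V))"
        using cls_tau_eq_locally [OF F H f(1) h(1) _ False] f h by metis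
      then show ?thesis
        using f by blast
    next
      case True
      \<comment> \<open>Both arrows over x end at the same point and cannot be separated.
        \<open>K\<close> sends x elsewhere, so near x it is comparable with \<open>F\<close> and
        with \<open>H\<close>.\<close>
      obtain K where K: "displacing K" "src G f \<in> src G ` K" "rng G ` K \<inter> rng G ` restr F (src G ` K) = {}"
        using exists_displacing [OF bF f(1)] by metis
      then obtain k where k: "k \<in> K" "src G k = x"
        using f by auto
      have "f \<in> restr F (src G ` K)"
        using f K(2) by (simp add: restr_def)
      then have ne: "rng G k \<noteq> rng G f"
        using K(3) k(1) by (metis IntI empty_iff imageI)
      obtain W where W: "compact_open (gtop G) W" "x \<in> W" "W \<subseteq> src G ` F"
        "\<And>V. compact_open (gtop G) V \<Longrightarrow> V \<subseteq> W \<Longrightarrow> cls (tau G (restr K V)) = cls (tau G (restr F V))"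
        using cls_tau_eq_locally [OF K(1) F k(1) f(1) _ ne] k f by metis
      obtain W' where W': "compact_open (gtop G) W'" "x \<in> W'" "W' \<subseteq> src G ` H"
        "\<And>V. compact_open (gtop G) V \<Longrightarrow> V \<subseteq> W' \<Longrightarrow> cls (tau G (restr K V)) = cls (tau G (restr H V))"
        using cls_tau_eq_locally [OF K(1) H k(1) h(1) _ ne [unfolded True]] k h by metis
      have "compact_open (gtop G) (W \<inter> W')"
        using compact_open_Int [OF U(1) W(1) _ W'(1)] W W' s by auto
      moreover have "cls (tau G (restr F V)) = cls (tau G (restr H V))"
        if "compact_open (gtop G) V" "V \<subseteq> W \<inter> W'" for V
        using W(4) [of V] W'(4) [of V] that by (metis le_inf_iff)
      ultimately show ?thesis
        using W(2,3) W'(2) by (intro exI [of _ "W \<inter> W'"]) blast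
    qed
  qed
  then show ?thesis
    using s restr_src by metis
qed

text \<open>Passing to inverses exchanges source and range and leaves the involution
  unchanged.\<close>

lemma cls_tau_eq_range:
  assumes F: "displacing F" and H: "displacing H" and r: "rng G ` F = rng G ` H"
  shows "cls (tau G F) = cls (tau G H)"
  using cls_tau_eq_source [OF displacing_inv [OF F] displacing_inv [OF H]] r
    displacing_subset_arrows [OF F] displacing_subset_arrows [OF H]
  by (simp add: tau_inv F H src_image_inv)

text \<open>F and K share their source, K and K B^{-1} their range, K B^{-1} and H their source
  r(B). The middle bisection K B^{-1} leads from r(B) to r(K), hence is displacing by
  \<open>dj\<close>.\<close>

lemma cls_tau_transport:
  assumes K: "displacing K" and F: "displacing F" and H: "displacing H" and B: "bisection G B"
    and s: "src G ` F = src G ` B" "src G ` K = src G ` B" and r: "src G ` H = rng G ` B"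
    and dj: "rng G ` K \<inter> rng G ` B = {}"
  shows "cls (tau G F) = cls (tau G H)"
proof -
  have bK: "bisection G K"
    using K by (simp add: displacing_def)
  let ?L = "setcomp G K (ginv G ` B)"
  have L: "src G ` ?L = rng G ` B" "rng G ` ?L = rng G ` K"
    using image_setcomp_inv [OF bK B s(2)] by auto
  then have dL: "displacing ?L"
    using bK B dj bisection_setcomp bisection_inv by (auto simp: displacing_def)
  have "cls (tau G F) = cls (tau G K)"
    using s by (intro cls_tau_eq_source F K) simp
  also have "\<dots> = cls (tau G ?L)"
    using L by (intro cls_tau_eq_range K dL) simp
  also have "\<dots> = cls (tau G H)"
    using L r by (intro cls_tau_eq_source dL H) simp
  finally show ?thesis .
qed

lemma rng_image_restr_Un: "rng G ` restr B (V \<union> W) = rng G ` restr B V \<union> rng G ` restr B W"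
  by (simp add: restr_Un image_Un)

lemma rng_image_restr_disjoint:
  assumes "bisection G B" "V \<inter> W = {}"
  shows "rng G ` restr B V \<inter> rng G ` restr B W = {}"
proof (rule ccontr)
  assume "rng G ` restr B V \<inter> rng G ` restr B W \<noteq> {}"
  then obtain v w where vw: "v \<in> restr B V" "w \<in> restr B W" "rng G v = rng G w"
    by auto
  then have "v = w"
    using inj_onD [OF bisection_inj_rng [OF assms(1)]] by (auto simp: restr_def)
  then show False
    using vw assms(2) by (auto simp: restr_def)
qed

text \<open>\<open>B\<close> itself need not be displacing, and a suitable \<open>K\<close> exists
  only locally, so the transport lemma is applied on small pieces of s(B) and additivity collects
  them.\<close>

lemma cls_tau_eq:
  assumes F: "displacing F" and H: "displacing H" and B: "bisection G B"
    and s: "src G ` F = src G ` B" and r: "src G ` H = rng G ` B"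
  shows "cls (tau G F) = cls (tau G H)"
proof -
  note U = compact_open_src [OF B]
  have "cls (tau G (restr F (src G ` B))) = cls (tau G (restr H (rng G ` restr B (src G ` B))))"
    using U(1)
  proof (induction rule: compact_open_induct)
    case empty
    then show ?case by simp
  next
    case (union V W)
    have Vu: "V \<subseteq> units G" "W \<subseteq> units G"
      using union U by auto
    note co = compact_open_rng [OF bisection_restr [OF B union(1) Vu(1)]]
      compact_open_rng [OF bisection_restr [OF B union(2) Vu(2)]]
    show ?case
      unfolding rng_image_restr_Un cls_tau_restr_Un [OF F union(1) Vu(1) union(2) Vu(2) union(5)]
        cls_tau_restr_Un [OF H co rng_image_restr_disjoint [OF B union(5)]] union by simp
  next
    case (basis x)
    then obtain b where b: "b \<in> B" "x = src G b"
      by blast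
    obtain K where K: "displacing K" "src G b \<in> src G ` K" "src G ` K \<subseteq> src G ` B"
      "rng G ` K \<inter> rng G ` restr B (src G ` K) = {}"
      using exists_displacing [OF B b(1)] .
    have bK: "bisection G K"
      using K by (simp add: displacing_def)
    show ?case
    proof (intro exI [of _ "src G ` K"] conjI allI impI, goal_cases)
      case (4 V)
      then have V: "compact_open (gtop G) V" "V \<subseteq> src G ` K" "V \<subseteq> units G"
        using compact_open_src [OF bK] by auto
      have sV: "src G ` restr F V = V" "src G ` restr K V = V" "src G ` restr B V = V"
        using V K s by (intro src_image_restr; blast)+
      have co: "compact_open (gtop G) (rng G ` restr B V)" "rng G ` restr B V \<subseteq> units G"
        using compact_open_rng bisection_restr [OF B V(1,3)] by auto
      have "rng G ` restr B V \<subseteq> src G ` H"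
        using r restr_subset by blast
      then have sH: "src G ` restr H (rng G ` restr B V) = rng G ` restr B V"
        by (rule src_image_restr)
      have dj: "rng G ` restr K V \<inter> rng G ` restr B V = {}"
        using K(4) rng_restr_mono [OF V(2), of B] restr_subset [of K V] by blast
      show ?case
        using sV sH dj
        by (intro cls_tau_transport [of "restr K V" _ _ "restr B V"] displacing_restr
              bisection_restr F H K(1) B V co) simp_all
    qed (use K b compact_open_src [OF bK] in auto)
  qed
  then show ?thesis
    using s r restr_src by metis
qed

text \<open>The conjugate of tau_F by \<open>g\<close> is tau of g F g^{-1}, whose source is the
  image of s(F) under the bisection \<open>restr g\<close> over s(F). By \<open>cls_tau_eq\<close>
  conjugation does not change the class.\<close>

lemma cls_tau_commute:
  assumes F: "displacing F" and g: "g \<in> carrier (S_group G)"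
  shows "cls g \<otimes>\<^bsub>quot\<^esub> cls (tau G F) = cls (tau G F) \<otimes>\<^bsub>quot\<^esub> cls g"
proof -
  have gf: "g \<in> carrier (full_group G)"
    using g by (rule S_group_in_full_group)
  have bg: "bisection G g" and sg: "src G ` g = units G" and bF: "bisection G F"
    using gf F by (auto simp: mem_full_group displacing_def)
  note U = compact_open_src [OF bF] and C = displacing_conj [OF F gf]
  have sub: "F \<subseteq> arrows G" "g \<subseteq> arrows G" "setcomp G g F \<subseteq> arrows G" "ginv G ` g \<subseteq> arrows G"
    using bF bg bisection_subset_arrows bisection_setcomp bisection_inv by auto
  have sgF: "src G ` setcomp G g F = src G ` F"
    unfolding src_image_setcomp [OF sub(2,1)] sg using sub(1) by (auto simp: rng_in_units subset_iff)
  have "src G ` conj_bisection g F = rng G ` restr g (src G ` F)"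
    unfolding conj_bisection_def src_image_setcomp [OF sub(3,4)] sgF
  proof (intro equalityI subsetI)
    fix x assume "x \<in> {src G b |b. b \<in> ginv G ` g \<and> rng G b \<in> src G ` F}"
    then obtain a where "a \<in> g" "x = src G (ginv G a)" "rng G (ginv G a) \<in> src G ` F"
      by blast
    then show "x \<in> rng G ` restr g (src G ` F)"
      using sub(2) by (auto simp: restr_def src_inv rng_inv subset_iff)
  next
    fix x assume "x \<in> rng G ` restr g (src G ` F)"
    then obtain a where "a \<in> g" "src G a \<in> src G ` F" "x = rng G a"
      by (auto simp: restr_def)
    then show "x \<in> {src G b |b. b \<in> ginv G ` g \<and> rng G b \<in> src G ` F}"
      using sub(2) by (intro CollectI exI [of _ "ginv G a"]) (auto simp: src_inv rng_inv)
  qed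
  moreover have "src G ` restr g (src G ` F) = src G ` F"
    using U(2) sg by (intro src_image_restr) simp
  ultimately have "cls (tau G F) = cls (tau G (conj_bisection g F))"
    using bisection_restr [OF bg U] by (intro cls_tau_eq F C(1)) simp_all
  then have eq: "cls (tau G F) = cls (conj_bisection g (tau G F))"
    using C(2) by simp
  have "setcomp G (conj_bisection g (tau G F)) g = setcomp G g (tau G F)"
    using full_group_subset_arrows [OF tau_in_full_group [OF F]] inv_image_setcomp [OF bg] sg
      bisection_subset_arrows [OF bisection_setcomp [OF bg]] tau_in_full_group [OF F]
    by (simp add: conj_bisection_def setcomp_assoc setcomp_units_right mem_full_group)
  moreover have "conj_bisection g (tau G F) \<in> carrier (S_group G)"
    using C tau_in_S_group by metis
  ultimately show ?thesis
    using eq cls_mult [OF g tau_in_S_group [OF F]] cls_mult [of "conj_bisection g (tau G F)" g] g by simp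
qed

text \<open>The classes of the generators commute with everything, and this passes to products in
  one of the two factors.\<close>

sublocale Q: comm_group quot
proof (rule Q.group_comm_groupI)
  fix q q' assume "q \<in> carrier quot" "q' \<in> carrier quot"
  then obtain g g' where g: "g \<in> carrier (S_group G)" "g' \<in> carrier (S_group G)" "q = cls g" "q' = cls g'"
    by (auto simp: carrier_FactGroup)
  have "cls g \<otimes>\<^bsub>quot\<^esub> cls g' = cls g' \<otimes>\<^bsub>quot\<^esub> cls g"
    using g(2)
  proof (induction rule: S_group_induct)
    case one
    then show ?case using cls_closed [OF g(1)] by (simp add: cls_units)
  next
    case (tau F)
    then show ?case using cls_tau_commute g(1) by simp
  next
    case (mult x y)
    then show ?case
      using cls_closed g(1) by (simp add: cls_mult) (metis Q.m_assoc)
  qed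
  then show "q \<otimes>\<^bsub>quot\<^esub> q' = q' \<otimes>\<^bsub>quot\<^esub> q"
    using g by simp
qed

lemma quot_square:
  assumes "q \<in> carrier quot"
  shows "q \<otimes>\<^bsub>quot\<^esub> q = \<one>\<^bsub>quot\<^esub>"
proof -
  obtain g where g: "g \<in> carrier (S_group G)" "q = cls g"
    using assms by (auto simp: carrier_FactGroup)
  have "cls g \<otimes>\<^bsub>quot\<^esub> cls g = \<one>\<^bsub>quot\<^esub>"
    using g(1)
  proof (induction rule: S_group_induct)
    case one
    then show ?case by (simp add: cls_units)
  next
    case (tau F)
    then show ?case by (rule cls_tau_square)
  next
    case (mult x y)
    then have "cls x \<in> carrier quot" "cls y \<in> carrier quot"
      by (auto intro: cls_closed)
    then have "(cls x \<otimes>\<^bsub>quot\<^esub> cls y) \<otimes>\<^bsub>quot\<^esub> (cls x \<otimes>\<^bsub>quot\<^esub> cls y)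
        = (cls x \<otimes>\<^bsub>quot\<^esub> cls x) \<otimes>\<^bsub>quot\<^esub> (cls y \<otimes>\<^bsub>quot\<^esub> cls y)"
      by (simp only: Q.m_ac Q.m_closed)
    then show ?case
      using mult by (simp add: cls_mult)
  qed
  then show ?thesis
    using g by simp
qed

end

section \<open>The additive function induced by the involutions\<close>

context large_orbit_groupoid begin

text \<open>A finitely additive function on the compact open subsets of \<open>U\<close> that
  prolongs F to the class of tau_F. It is relative to \<open>U\<close> so that one on the whole unit
  space can be assembled from small sets, on which a displacing bisection is at hand.\<close>

definition tau_valuation :: "'a set \<Rightarrow> ('a set \<Rightarrow> 'a set set) \<Rightarrow> bool" where
  "tau_valuation U f \<longleftrightarrow>
     (\<forall>V. compact_open (gtop G) V \<and> V \<subseteq> U \<longrightarrow> f V \<in> carrier quot) \<and>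
     (\<forall>V W. compact_open (gtop G) V \<and> compact_open (gtop G) W \<and> V \<subseteq> U \<and> W \<subseteq> U \<and> V \<inter> W = {} \<longrightarrow>
        f (V \<union> W) = f V \<otimes>\<^bsub>quot\<^esub> f W) \<and>
     (\<forall>F. displacing F \<and> src G ` F \<subseteq> U \<longrightarrow> f (src G ` F) = cls (tau G F))"

lemma
  assumes "tau_valuation U f"
  shows tau_valuation_closed: "\<And>V. compact_open (gtop G) V \<Longrightarrow> V \<subseteq> U \<Longrightarrow> f V \<in> carrier quot"
    and tau_valuation_Un: "\<And>V W. compact_open (gtop G) V \<Longrightarrow> compact_open (gtop G) W \<Longrightarrow> V \<subseteq> U \<Longrightarrow> W \<subseteq> U
          \<Longrightarrow> V \<inter> W = {} \<Longrightarrow> f (V \<union> W) = f V \<otimes>\<^bsub>quot\<^esub> f W"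
    and tau_valuation_tau: "\<And>F. displacing F \<Longrightarrow> src G ` F \<subseteq> U \<Longrightarrow> f (src G ` F) = cls (tau G F)"
proof -
  note * = assms [unfolded tau_valuation_def]
  show "\<And>V. compact_open (gtop G) V \<Longrightarrow> V \<subseteq> U \<Longrightarrow> f V \<in> carrier quot"
    using conjunct1 [OF *] by simp
  show "\<And>V W. compact_open (gtop G) V \<Longrightarrow> compact_open (gtop G) W \<Longrightarrow> V \<subseteq> U \<Longrightarrow> W \<subseteq> U
          \<Longrightarrow> V \<inter> W = {} \<Longrightarrow> f (V \<union> W) = f V \<otimes>\<^bsub>quot\<^esub> f W"
    using conjunct1 [OF conjunct2 [OF *]] by simp
  show "\<And>F. displacing F \<Longrightarrow> src G ` F \<subseteq> U \<Longrightarrow> f (src G ` F) = cls (tau G F)"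
    using conjunct2 [OF conjunct2 [OF *]] by simp
qed

lemma exists_tau_valuation: "\<exists>f. tau_valuation (units G) f"
  using compact_open_units
proof (induction rule: compact_open_induct)
  case empty
  have "cls (tau G F) = \<one>\<^bsub>quot\<^esub>" if "src G ` F \<subseteq> {}" for F
    using that cls_units by (simp add: tau_def)
  then show ?case
    by (intro exI [of _ "\<lambda>_. \<one>\<^bsub>quot\<^esub>"]) (simp add: tau_valuation_def)
next
  case (basis x)
  obtain K where K: "displacing K" "src G x \<in> src G ` K"
    using exists_displacing [OF bisection_units basis] by metis
  then have bK: "bisection G K" and x: "x \<in> src G ` K"
    using basis by (simp_all add: displacing_def src_unit)
  note U = compact_open_src [OF bK]
  \<comment> \<open>A displacing \<open>K\<close> over x defines the value of every compact open
    subset of s(K) by restriction; the third clause is then the dependence on the source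
    only.\<close>
  have "tau_valuation V (\<lambda>V. cls (tau G (restr K V)))" if V: "V \<subseteq> src G ` K" for V
    unfolding tau_valuation_def
  proof (intro conjI allI impI; elim conjE)
    fix W assume W: "compact_open (gtop G) W" "W \<subseteq> V"
    then show "cls (tau G (restr K W)) \<in> carrier quot"
      using K V U by (intro cls_tau_closed displacing_restr) auto
    fix W' assume "compact_open (gtop G) W'" "W' \<subseteq> V" "W \<inter> W' = {}"
    then show "cls (tau G (restr K (W \<union> W'))) = cls (tau G (restr K W)) \<otimes>\<^bsub>quot\<^esub> cls (tau G (restr K W'))"
      using W V U by (intro cls_tau_restr_Un K) auto
  next
    fix F assume F: "displacing F" "src G ` F \<subseteq> V"
    then have "compact_open (gtop G) (src G ` F)" "src G ` F \<subseteq> units G"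
      using compact_open_src by (auto simp: displacing_def)
    then show "cls (tau G (restr K (src G ` F))) = cls (tau G F)"
      using F V src_image_restr [of "src G ` F" K] by (intro cls_tau_eq_source displacing_restr K) auto
  qed
  then show ?case
    using U x by blast
next
  case (union V W)
  then obtain f g where f: "tau_valuation V f" and g: "tau_valuation W g"
    by blast
  have co: "compact_open (gtop G) (X \<inter> V)" "compact_open (gtop G) (X \<inter> W)"
    if "compact_open (gtop G) X" "X \<subseteq> V \<union> W" for X
  proof -
    have "X \<subseteq> units G"
      using that(2) union(3,4) by blast
    then show "compact_open (gtop G) (X \<inter> V)" "compact_open (gtop G) (X \<inter> W)"
      using compact_open_Int [OF compact_open_units that(1)] union(1-4) by blast+
  qed
  \<comment> \<open>Gluing over the disjoint sets \<open>V\<close> and \<open>W\<close>: each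
    \<open>X\<close> is split along them. Additivity rearranges four factors, for which the quotient
    must be abelian.\<close>
  have *: "tau_valuation (V \<union> W) (\<lambda>X. f (X \<inter> V) \<otimes>\<^bsub>quot\<^esub> g (X \<inter> W))"
    unfolding tau_valuation_def
  proof (intro conjI allI impI; elim conjE)
    fix X assume X: "compact_open (gtop G) X" "X \<subseteq> V \<union> W"
    have cX: "f (X \<inter> V) \<in> carrier quot" "g (X \<inter> W) \<in> carrier quot"
      using tau_valuation_closed [OF f co(1)] tau_valuation_closed [OF g co(2)] X by auto
    then show "f (X \<inter> V) \<otimes>\<^bsub>quot\<^esub> g (X \<inter> W) \<in> carrier quot"
      by (rule Q.m_closed)
    fix Y assume Y: "compact_open (gtop G) Y" "Y \<subseteq> V \<union> W" "X \<inter> Y = {}"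
    have cY: "f (Y \<inter> V) \<in> carrier quot" "g (Y \<inter> W) \<in> carrier quot"
      using tau_valuation_closed [OF f co(1)] tau_valuation_closed [OF g co(2)] Y by auto
    have "f ((X \<inter> V) \<union> (Y \<inter> V)) = f (X \<inter> V) \<otimes>\<^bsub>quot\<^esub> f (Y \<inter> V)"
      using X Y by (intro tau_valuation_Un [OF f] co) auto
    moreover have "g ((X \<inter> W) \<union> (Y \<inter> W)) = g (X \<inter> W) \<otimes>\<^bsub>quot\<^esub> g (Y \<inter> W)"
      using X Y by (intro tau_valuation_Un [OF g] co) auto
    ultimately show "f ((X \<union> Y) \<inter> V) \<otimes>\<^bsub>quot\<^esub> g ((X \<union> Y) \<inter> W)
        = (f (X \<inter> V) \<otimes>\<^bsub>quot\<^esub> g (X \<inter> W)) \<otimes>\<^bsub>quot\<^esub> (f (Y \<inter> V) \<otimes>\<^bsub>quot\<^esub> g (Y \<inter> W))"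
      using cX cY by (simp add: Int_Un_distrib2 Q.m_ac)
  next
    fix F assume F: "displacing F" "src G ` F \<subseteq> V \<union> W"
    then have bF: "bisection G F"
      by (simp add: displacing_def)
    note U = compact_open_src [OF bF]
    let ?V = "src G ` F \<inter> V" and ?W = "src G ` F \<inter> W"
    have cVW: "compact_open (gtop G) ?V" "compact_open (gtop G) ?W" "?V \<subseteq> units G" "?W \<subseteq> units G"
      using co [OF U(1) F(2)] U(2) by auto
    have "f ?V = cls (tau G (restr F ?V))"
      using tau_valuation_tau [OF f displacing_restr [OF F(1) cVW(1,3)]] src_image_restr [of ?V F] by simp
    moreover have "g ?W = cls (tau G (restr F ?W))"
      using tau_valuation_tau [OF g displacing_restr [OF F(1) cVW(2,4)]] src_image_restr [of ?W F] by simp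
    moreover have "cls (tau G (restr F (?V \<union> ?W))) = cls (tau G (restr F ?V)) \<otimes>\<^bsub>quot\<^esub> cls (tau G (restr F ?W))"
      using union(5) by (intro cls_tau_restr_Un F(1) cVW) auto
    moreover have "restr F (?V \<union> ?W) = F"
      using F(2) by (auto simp: restr_def)
    ultimately show "f ?V \<otimes>\<^bsub>quot\<^esub> g ?W = cls (tau G F)"
      by simp
  qed
  show ?case by (rule exI, rule *)
qed

definition phi :: "'a set \<Rightarrow> 'a set set" where
  "phi = (SOME f. tau_valuation (units G) f)"

lemma tau_valuation_phi: "tau_valuation (units G) phi"
  unfolding phi_def using exists_tau_valuation by (rule someI_ex)

lemmas phi_closed = tau_valuation_closed [OF tau_valuation_phi]
  and phi_Un = tau_valuation_Un [OF tau_valuation_phi]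

lemma phi_src:
  assumes "displacing F"
  shows "phi (src G ` F) = cls (tau G F)"
  using tau_valuation_tau [OF tau_valuation_phi assms] compact_open_src(2) [of F] assms
  by (simp add: displacing_def)

lemma phi_empty: "phi {} = \<one>\<^bsub>quot\<^esub>"
proof -
  have "displacing {}"
    by (simp add: displacing_def bisection_iff)
  then show ?thesis
    using phi_src [of "{}"] cls_units by (simp add: tau_def)
qed

text \<open>The invariance that will kill boundaries. Here s(B) and r(B) need not be sources of
  displacing bisections, so the comparison is local again.\<close>

lemma phi_rng_eq_phi_src:
  assumes B: "bisection G B"
  shows "phi (rng G ` B) = phi (src G ` B)"
proof -
  note U = compact_open_src [OF B]
  have "phi (rng G ` restr B (src G ` B)) = phi (src G ` B)"
    using U(1)
  proof (induction rule: compact_open_induct)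
    case empty
    then show ?case by simp
  next
    case (union V W)
    have Vu: "V \<subseteq> units G" "W \<subseteq> units G"
      using union U by auto
    note co = compact_open_rng [OF bisection_restr [OF B union(1) Vu(1)]]
      compact_open_rng [OF bisection_restr [OF B union(2) Vu(2)]]
    show ?case
      unfolding rng_image_restr_Un phi_Un [OF co(1,3,2,4) rng_image_restr_disjoint [OF B union(5)]]
        phi_Un [OF union(1,2) Vu union(5)] union ..
  next
    case (basis x)
    then obtain b where b: "b \<in> B" "x = src G b"
      by blast
    obtain K where K: "displacing K" "src G b \<in> src G ` K" "src G ` K \<subseteq> src G ` B"
      "rng G ` K \<inter> rng G ` restr B (src G ` K) = {}"
      using exists_displacing [OF B b(1)] .
    have bK: "bisection G K"
      using K by (simp add: displacing_def)
    show ?case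
    proof (intro exI [of _ "src G ` K"] conjI allI impI, goal_cases)
      case (4 V)
      then have V: "compact_open (gtop G) V" "V \<subseteq> src G ` K" "V \<subseteq> units G"
        using compact_open_src [OF bK] by auto
      let ?K = "restr K V" and ?B = "restr B V"
      have dK: "displacing ?K" and bK': "bisection G ?K" and bB: "bisection G ?B"
        using displacing_restr [OF K(1) V(1,3)] bisection_restr [OF bK V(1,3)] bisection_restr [OF B V(1,3)]
        by auto
      have sV: "src G ` ?K = V" "src G ` ?B = V"
        using V K by (intro src_image_restr; blast)+
      \<comment> \<open>\<open>?L\<close> starts on the range of the small piece of \<open>B\<close>
        and has the range of \<open>?K\<close>, so its class is both the value on r(B) and the value
        on s(B) over \<open>V\<close>.\<close>
      let ?L = "setcomp G ?K (ginv G ` ?B)"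
      have L: "src G ` ?L = rng G ` ?B" "rng G ` ?L = rng G ` ?K"
        using image_setcomp_inv [OF bK' bB] sV by auto
      have "rng G ` ?K \<inter> rng G ` ?B = {}"
        using K(4) rng_restr_mono [OF V(2), of B] restr_subset [of K V] by blast
      then have dL: "displacing ?L"
        using L bK' bB bisection_setcomp bisection_inv by (auto simp: displacing_def)
      have "phi (rng G ` ?B) = cls (tau G ?L)"
        using phi_src [OF dL] L by simp
      also have "\<dots> = cls (tau G ?K)"
        using L by (intro cls_tau_eq_range dL dK) simp
      also have "\<dots> = phi V"
        using phi_src [OF dK] sV by simp
      finally show ?case .
    qed (use K b compact_open_src [OF bK] in auto)
  qed
  then show ?thesis
    using restr_src by metis
qed

text \<open>Symmetric difference is addition of indicators modulo 2. The common part of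
  \<open>V\<close> and \<open>W\<close> enters the right-hand side twice and disappears because
  squares are trivial.\<close>

lemma phi_symmetric_difference:
  assumes V: "compact_open (gtop G) V" "V \<subseteq> units G" and W: "compact_open (gtop G) W" "W \<subseteq> units G"
  shows "phi ((V - W) \<union> (W - V)) = phi V \<otimes>\<^bsub>quot\<^esub> phi W"
proof -
  have co: "compact_open (gtop G) (V - W)" "compact_open (gtop G) (W - V)" "compact_open (gtop G) (V \<inter> W)"
    using compact_open_Diff [OF compact_open_units] compact_open_Int [OF compact_open_units] V W by blast+
  have sub: "V - W \<subseteq> units G" "W - V \<subseteq> units G" "V \<inter> W \<subseteq> units G"
    using V W by auto
  have c: "phi (V - W) \<in> carrier quot" "phi (W - V) \<in> carrier quot" "phi (V \<inter> W) \<in> carrier quot"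
    using phi_closed co sub by blast+
  have "phi ((V - W) \<union> (V \<inter> W)) = phi (V - W) \<otimes>\<^bsub>quot\<^esub> phi (V \<inter> W)"
    by (intro phi_Un co sub) auto
  moreover have "phi ((W - V) \<union> (V \<inter> W)) = phi (W - V) \<otimes>\<^bsub>quot\<^esub> phi (V \<inter> W)"
    by (intro phi_Un co sub) auto
  moreover have "phi ((V - W) \<union> (W - V)) = phi (V - W) \<otimes>\<^bsub>quot\<^esub> phi (W - V)"
    by (intro phi_Un co sub) auto
  moreover have "(V - W) \<union> (V \<inter> W) = V" "(W - V) \<union> (V \<inter> W) = W"
    by auto
  moreover have "(phi (V - W) \<otimes>\<^bsub>quot\<^esub> phi (V \<inter> W)) \<otimes>\<^bsub>quot\<^esub> (phi (W - V) \<otimes>\<^bsub>quot\<^esub> phi (V \<inter> W))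
      = phi (V - W) \<otimes>\<^bsub>quot\<^esub> phi (W - V) \<otimes>\<^bsub>quot\<^esub> (phi (V \<inter> W) \<otimes>\<^bsub>quot\<^esub> phi (V \<inter> W))"
    using c by (simp only: Q.m_ac Q.m_closed)
  ultimately show ?thesis
    using quot_square [OF c(3)] c by simp
qed

end

section \<open>Compactly supported functions and boundaries\<close>

lemma comm_group_function_group: "comm_group (function_group X :: ('x \<Rightarrow> 'a::ab_group_add) monoid)"
proof (rule comm_groupI)
  fix f :: "'x \<Rightarrow> 'a" assume "f \<in> carrier (function_group X)"
  then show "\<exists>g\<in>carrier (function_group X). g \<otimes>\<^bsub>function_group X\<^esub> f = \<one>\<^bsub>function_group X\<^esub>"
    by (intro bexI [of _ "\<lambda>x. - f x"]) (auto simp: function_group_def)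
qed (auto simp: function_group_def algebra_simps)

lemma inv_function_group:
  assumes "f \<in> carrier (function_group X)"
  shows "inv\<^bsub>function_group X\<^esub> f = (\<lambda>x. - f x)"
proof -
  interpret comm_group "function_group X" by (rule comm_group_function_group)
  show ?thesis
    using assms by (intro inv_equality) (auto simp: function_group_def)
qed

lemma
  shows mult_C_c [simp]: "monoid.mult (C_c X) = (\<lambda>f g x. f x + g x)"
    and one_C_c [simp]: "one (C_c X) = (\<lambda>_. 0)"
  by (simp_all add: C_c_def function_group_def)

lemma comm_group_C_c: "comm_group (C_c X)"
  unfolding C_c_def
  by (intro group.abelian_subgroup_generated comm_group_function_group comm_group.axioms(2))

abbreviation const_on :: "'x set \<Rightarrow> 'a \<Rightarrow> 'x \<Rightarrow> 'a::zero" where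
  "const_on U a \<equiv> \<lambda>x. if x \<in> U then a else 0"

lemma carrier_C_c:
  "carrier (C_c X) = generate (function_group X) {const_on U a | U a. compact_open X U}"
  (is "_ = generate _ ?S")
proof -
  have "?S \<subseteq> carrier (function_group X)"
    using openin_subset by (fastforce simp: function_group_def compact_open_def)
  then show ?thesis
    unfolding C_c_def carrier_subgroup_generated by (simp only: inf.absorb2)
qed

lemma const_on_in_C_c: "compact_open X U \<Longrightarrow> const_on U a \<in> carrier (C_c X)"
  unfolding carrier_C_c by (auto intro!: generate.incl)

text \<open>The inverse of a constant a on \<open>U\<close> is the constant -a on \<open>U\<close>,
  so inverses are absorbed by \<open>const\<close>.\<close>

lemma C_c_induct [consumes 1, case_names zero const add]:
  assumes "f \<in> carrier (C_c X)"
    and zero: "P (\<lambda>_. 0)"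
    and const: "\<And>U a. compact_open X U \<Longrightarrow> P (const_on U a)"
    and add: "\<And>f g. f \<in> carrier (C_c X) \<Longrightarrow> g \<in> carrier (C_c X) \<Longrightarrow> P f \<Longrightarrow> P g \<Longrightarrow> P (\<lambda>x. f x + g x)"
  shows "P f"
  using assms(1) unfolding carrier_C_c
proof (induction rule: generate.induct)
  case one
  then show ?case using zero by (simp add: function_group_def)
next
  case (incl h)
  then show ?case using const by auto
next
  case (inv h)
  then obtain U a where U: "compact_open X U" "h = const_on U a"
    by auto
  then have "h \<in> carrier (function_group X)"
    using openin_subset by (fastforce simp: function_group_def compact_open_def)
  then have "inv\<^bsub>function_group X\<^esub> h = const_on U (- a)"
    using U by (auto simp: inv_function_group)
  then show ?case using const U by simp
next
  case (eng h1 h2)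
  then show ?case using add by (simp add: carrier_C_c function_group_def)
qed

lemma const_on_Un: "V \<inter> W = {} \<Longrightarrow> const_on (V \<union> W) a = (\<lambda>x. const_on V a x + const_on W a x)"
  for a :: "'a::ab_group_add"
  by (auto simp: fun_eq_iff)

text \<open>The three sums run over different supports, which are replaced by one common finite set.
  Finiteness matters because a sum over an infinite set is 0 by convention.\<close>

lemma sum_support_add:
  fixes f g :: "'x \<Rightarrow> 'a::ab_group_add"
  assumes "finite {y \<in> A. f y \<noteq> 0}" "finite {y \<in> A. g y \<noteq> 0}"
  shows "(\<Sum>y | y \<in> A \<and> f y + g y \<noteq> 0. f y + g y) = (\<Sum>y | y \<in> A \<and> f y \<noteq> 0. f y) + (\<Sum>y | y \<in> A \<and> g y \<noteq> 0. g y)"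
proof -
  let ?S = "{y \<in> A. f y \<noteq> 0} \<union> {y \<in> A. g y \<noteq> 0}"
  have S: "finite ?S"
    using assms by simp
  have "(\<Sum>y | y \<in> A \<and> f y + g y \<noteq> 0. f y + g y) = (\<Sum>y\<in>?S. f y + g y)"
    using S by (intro sum.mono_neutral_left) auto
  also have "\<dots> = (\<Sum>y\<in>?S. f y) + (\<Sum>y\<in>?S. g y)"
    by (rule sum.distrib)
  also have "(\<Sum>y\<in>?S. f y) = (\<Sum>y | y \<in> A \<and> f y \<noteq> 0. f y)"
    using S by (intro sum.mono_neutral_right) auto
  also have "(\<Sum>y\<in>?S. g y) = (\<Sum>y | y \<in> A \<and> g y \<noteq> 0. g y)"
    using S by (intro sum.mono_neutral_right) auto
  finally show ?thesis .
qed

section \<open>The boundary map on bisections\<close>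

context compact_etale_groupoid begin

text \<open>A Hausdorff compact open set can be cut into finitely many disjoint bisections, so
  functions constant on bisections already generate.\<close>

lemma C_c_bisection_induct [consumes 1, case_names zero const add]:
  fixes f :: "'a \<Rightarrow> 'b::ab_group_add"
  assumes "f \<in> carrier (C_c (gtop G))"
    and zero: "P (\<lambda>_. 0)"
    and const: "\<And>B a. bisection G B \<Longrightarrow> P (const_on B a)"
    and add: "\<And>f g. f \<in> carrier (C_c (gtop G)) \<Longrightarrow> g \<in> carrier (C_c (gtop G)) \<Longrightarrow> P f \<Longrightarrow> P g \<Longrightarrow> P (\<lambda>x. f x + g x)"
  shows "P f"
  using assms(1)
proof (induction rule: C_c_induct)
  case zero
  then show ?case by (rule assms(2))
next
  case (add f g)
  then show ?case by (intro assms(4))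
next
  case (const U a)
  then show ?case
  proof (induction rule: compact_open_induct)
    case empty
    then show ?case using zero by simp
  next
    case (union V W)
    then show ?case
      unfolding const_on_Un [OF union(5)] by (intro add const_on_in_C_c)
  next
    case (basis x)
    then obtain B where B: "bisection G B" "x \<in> B" "B \<subseteq> U"
      using bisection_basis const by (metis compact_open_def)
    then show ?case
      using assms(3) bisection_subset bisection_compact_open by (intro exI [of _ B]) blast
  qed
qed

lemma finite_fibre_const_on:
  assumes "inj_on p B"
  shows "finite {y \<in> A. p y = x \<and> const_on B a y \<noteq> (0::'b::ab_group_add)}"
proof (rule finite_subset)
  show "{y \<in> A. p y = x \<and> const_on B a y \<noteq> 0} \<subseteq> {inv_into B p x}"
    using assms by (auto split: if_splits)
qed simp

text \<open>A bisection meets each fibre in at most one arrow. This makes the sums in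
  \<open>delta1\<close> genuine and hence additive.\<close>

lemma finite_fibres:
  fixes f :: "'a \<Rightarrow> 'b::ab_group_add"
  assumes "f \<in> carrier (C_c (gtop G))"
  shows "finite {y \<in> arrows G. src G y = x \<and> f y \<noteq> 0} \<and> finite {y \<in> arrows G. rng G y = x \<and> f y \<noteq> 0}"
  using assms
proof (induction rule: C_c_bisection_induct)
  case zero
  then show ?case by simp
next
  case (const B a)
  then show ?case
    by (intro conjI finite_fibre_const_on bisection_inj_src bisection_inj_rng)
next
  case (add f g)
  have "{y \<in> arrows G. src G y = x \<and> f y + g y \<noteq> 0}
      \<subseteq> {y \<in> arrows G. src G y = x \<and> f y \<noteq> 0} \<union> {y \<in> arrows G. src G y = x \<and> g y \<noteq> 0}"
    "{y \<in> arrows G. rng G y = x \<and> f y + g y \<noteq> 0}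
      \<subseteq> {y \<in> arrows G. rng G y = x \<and> f y \<noteq> 0} \<union> {y \<in> arrows G. rng G y = x \<and> g y \<noteq> 0}"
    by auto
  then show ?case
    using add finite_subset finite_UnI by (metis (no_types, lifting))
qed

lemma delta1_add:
  fixes f g :: "'a \<Rightarrow> 'b::ab_group_add"
  assumes "f \<in> carrier (C_c (gtop G))" "g \<in> carrier (C_c (gtop G))"
  shows "delta1 G (\<lambda>y. f y + g y) = (\<lambda>x. delta1 G f x + delta1 G g x)"
proof
  fix x
  have "(\<Sum>y | y \<in> arrows G \<and> src G y = x \<and> f y + g y \<noteq> 0. f y + g y)
      = (\<Sum>y | y \<in> arrows G \<and> src G y = x \<and> f y \<noteq> 0. f y) + (\<Sum>y | y \<in> arrows G \<and> src G y = x \<and> g y \<noteq> 0. g y)"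
    using sum_support_add [of "{y \<in> arrows G. src G y = x}" f g] finite_fibres [OF assms(1), of x]
      finite_fibres [OF assms(2), of x] by simp
  moreover have "(\<Sum>y | y \<in> arrows G \<and> rng G y = x \<and> f y + g y \<noteq> 0. f y + g y)
      = (\<Sum>y | y \<in> arrows G \<and> rng G y = x \<and> f y \<noteq> 0. f y) + (\<Sum>y | y \<in> arrows G \<and> rng G y = x \<and> g y \<noteq> 0. g y)"
    using sum_support_add [of "{y \<in> arrows G. rng G y = x}" f g] finite_fibres [OF assms(1), of x]
      finite_fibres [OF assms(2), of x] by simp
  ultimately show "delta1 G (\<lambda>y. f y + g y) x = delta1 G f x + delta1 G g x"
    by (simp add: delta1_def)
qed

lemma sum_fibre_const_on:
  fixes a :: "'b::ab_group_add"
  assumes "inj_on p B" "B \<subseteq> A"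
  shows "(\<Sum>y | y \<in> A \<and> p y = x \<and> const_on B a y \<noteq> 0. const_on B a y) = const_on (p ` B) a x"
proof (cases "a \<noteq> 0 \<and> x \<in> p ` B")
  case True
  then obtain b where b: "b \<in> B" "x = p b"
    by auto
  then have "{y. y \<in> A \<and> p y = x \<and> const_on B a y \<noteq> 0} = {b}"
    using assms True by (auto dest: inj_onD)
  then show ?thesis
    using b by simp
next
  case False
  then have "{y. y \<in> A \<and> p y = x \<and> const_on B a y \<noteq> 0} = {}"
    by auto
  then show ?thesis
    using False by (simp only: sum.empty) auto
qed

text \<open>The minus sign is put into the constant so that both terms are generators of
  \<open>C_c\<close>.\<close>

lemma delta1_const_on:
  fixes a :: "'b::ab_group_add"
  assumes "bisection G B"
  shows "delta1 G (const_on B a) = (\<lambda>x. const_on (src G ` B) a x + const_on (rng G ` B) (- a) x)"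
proof
  fix x
  have B: "B \<subseteq> arrows G"
    using assms by (rule bisection_subset_arrows)
  then have "x \<in> src G ` B \<Longrightarrow> x \<in> units G" "x \<in> rng G ` B \<Longrightarrow> x \<in> units G"
    using src_in_units rng_in_units by auto
  then show "delta1 G (const_on B a) x = const_on (src G ` B) a x + const_on (rng G ` B) (- a) x"
    unfolding delta1_def sum_fibre_const_on [OF bisection_inj_src [OF assms] B]
      sum_fibre_const_on [OF bisection_inj_rng [OF assms] B] by auto
qed

lemma delta1_closed:
  fixes f :: "'a \<Rightarrow> 'b::ab_group_add"
  assumes "f \<in> carrier (C_c (gtop G))"
  shows "delta1 G f \<in> carrier (C_c (unit_space G))"
proof -
  interpret C: comm_group "C_c (unit_space G) :: ('a \<Rightarrow> 'b) monoid"
    by (rule comm_group_C_c)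
  show ?thesis
    using assms
  proof (induction rule: C_c_bisection_induct)
    case zero
    have "delta1 G (\<lambda>_. 0 :: 'b) = (\<lambda>_. 0)"
      by (simp add: delta1_def fun_eq_iff)
    then show ?case
      using C.one_closed by simp
  next
    case (const B a)
    then show ?case
      using C.m_closed [OF const_on_in_C_c const_on_in_C_c, of "src G ` B" "rng G ` B"]
        compact_open_src compact_open_rng
      by (simp add: delta1_const_on compact_open_unit_space)
  next
    case (add f g)
    then show ?case
      using C.m_closed by (simp add: delta1_add)
  qed
qed

lemma boundaries_normal: "(boundaries G :: ('a \<Rightarrow> 'b::ab_group_add) set) \<lhd> C_c (unit_space G)"
proof -
  interpret B: comm_group "C_c (gtop G) :: ('a \<Rightarrow> 'b) monoid"
    by (rule comm_group_C_c)
  interpret C: comm_group "C_c (unit_space G) :: ('a \<Rightarrow> 'b) monoid"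
    by (rule comm_group_C_c)
  interpret group_hom "C_c (gtop G)" "C_c (unit_space G)" "delta1 G :: ('a \<Rightarrow> 'b) \<Rightarrow> _"
    by unfold_locales (auto simp: hom_def delta1_closed delta1_add)
  show ?thesis
    unfolding boundaries_def by (rule C.subgroup_imp_normal [OF img_is_subgroup])
qed

end

section \<open>The epimorphism\<close>

lemma bit_add_ne_0_iff: "a + b \<noteq> 0 \<longleftrightarrow> (a \<noteq> 0) \<noteq> (b \<noteq> 0)" for a b :: bit
  by (cases a; cases b) simp_all

lemma indicator_eq_const_on: "indicator U = const_on U 1"
  by (simp add: indicator_def fun_eq_iff)

lemma bit_eq_indicator: "f = indicator {x. f x \<noteq> 0}" for f :: "'x \<Rightarrow> bit"
  by (auto simp: indicator_def fun_eq_iff)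

context large_orbit_groupoid begin

text \<open>Modulo 2 a constant on \<open>U\<close> has support \<open>U\<close> or is zero, and
  addition takes the symmetric difference of supports. Compactly supported functions are therefore
  indicators of compact open sets.\<close>

lemma C_c_bit_support:
  fixes f :: "'a \<Rightarrow> bit"
  assumes "f \<in> carrier (C_c (unit_space G))"
  shows "compact_open (gtop G) {x. f x \<noteq> 0} \<and> {x. f x \<noteq> 0} \<subseteq> units G"
  using assms
proof (induction rule: C_c_induct)
  case zero
  then show ?case by (simp add: compact_open_def)
next
  case (const U a)
  then show ?case
    by (cases a) (simp_all add: compact_open_def compact_open_unit_space [unfolded compact_open_def])
next
  case (add f g)
  let ?f = "{x. f x \<noteq> 0}" and ?g = "{x. g x \<noteq> 0}"
  have eq: "{x. f x + g x \<noteq> 0} = (?f - ?g) \<union> (?g - ?f)"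
    unfolding bit_add_ne_0_iff by auto
  have f: "compact_open (gtop G) ?f" "?f \<subseteq> units G" and g: "compact_open (gtop G) ?g" "?g \<subseteq> units G"
    using add.IH by simp_all
  have sub: "?f - ?g \<subseteq> units G" "?g - ?f \<subseteq> units G"
    using f(2) g(2) by blast+
  show ?case
    unfolding eq
    using compact_open_Un [OF compact_open_units compact_open_Diff [OF compact_open_units f g] sub(1)
        compact_open_Diff [OF compact_open_units g f] sub(2)] sub
    by (simp only: Un_least simp_thms)
qed

text \<open>A function modulo 2 is the indicator of its support, so this is \<open>phi\<close>
  carried over to functions.\<close>

definition psi :: "('a \<Rightarrow> bit) \<Rightarrow> 'a set set" where
  "psi f = phi {x. f x \<noteq> 0}"

lemma psi_indicator: "psi (indicator U) = phi U"
  by (simp add: psi_def indicator_def)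

lemma psi_add:
  assumes "f \<in> carrier (C_c (unit_space G))" "g \<in> carrier (C_c (unit_space G))"
  shows "psi (\<lambda>x. f x + g x) = psi f \<otimes>\<^bsub>quot\<^esub> psi g"
proof -
  have "{x. f x + g x \<noteq> 0} = ({x. f x \<noteq> 0} - {x. g x \<noteq> 0}) \<union> ({x. g x \<noteq> 0} - {x. f x \<noteq> 0})"
    unfolding bit_add_ne_0_iff by auto
  then show ?thesis
    using C_c_bit_support assms phi_symmetric_difference by (simp add: psi_def)
qed

lemma psi_hom: "psi \<in> hom (C_c (unit_space G)) quot"
proof (rule homI)
  fix f :: "'a \<Rightarrow> bit" assume f: "f \<in> carrier (C_c (unit_space G))"
  show "psi f \<in> carrier quot"
    unfolding psi_def using C_c_bit_support [OF f] by (intro phi_closed) simp_all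
  fix g :: "'a \<Rightarrow> bit" assume "g \<in> carrier (C_c (unit_space G))"
  with f show "psi (f \<otimes>\<^bsub>C_c (unit_space G)\<^esub> g) = psi f \<otimes>\<^bsub>quot\<^esub> psi g"
    unfolding mult_C_c by (rule psi_add)
qed

text \<open>For a bisection \<open>B\<close> the boundary is the sum of the indicators of s(B) and
  r(B), as -1 = 1. Both have the same value, whose square is trivial.\<close>

lemma psi_delta1:
  assumes "f \<in> carrier (C_c (gtop G))"
  shows "psi (delta1 G f) = \<one>\<^bsub>quot\<^esub>"
  using assms
proof (induction rule: C_c_bisection_induct)
  case zero
  then show ?case
    by (simp add: delta1_def psi_def phi_empty cong: if_cong)
next
  case (const B a)
  note S = compact_open_src [OF const] and R = compact_open_rng [OF const]
  show ?case
  proof (cases a)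
    case zero
    then show ?thesis
      by (simp add: delta1_const_on [OF const] psi_def phi_empty)
  next
    case one
    have minus_one: "- 1 = (1 :: bit)"
      by simp
    have "psi (delta1 G (const_on B a)) = psi (\<lambda>x. indicator (src G ` B) x + indicator (rng G ` B) x)"
      unfolding delta1_const_on [OF const] one indicator_eq_const_on minus_one by (rule refl)
    also have "\<dots> = phi (src G ` B) \<otimes>\<^bsub>quot\<^esub> phi (rng G ` B)"
    proof (subst psi_add)
      show "indicator (src G ` B) \<in> carrier (C_c (unit_space G))"
        "indicator (rng G ` B) \<in> carrier (C_c (unit_space G))"
        unfolding indicator_eq_const_on using S R by (auto intro!: const_on_in_C_c simp: compact_open_unit_space)
    qed (simp add: psi_indicator)
    also have "\<dots> = \<one>\<^bsub>quot\<^esub>"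
      unfolding phi_rng_eq_phi_src [OF const] using S by (intro quot_square phi_closed)
    finally show ?thesis .
  qed
next
  case (add f g)
  show ?case
    unfolding delta1_add [OF add(1,2)] psi_add [OF delta1_closed [OF add(1)] delta1_closed [OF add(2)]] add.IH
    by simp
qed

lemma indicator_in_C_c:
  "compact_open (gtop G) U \<Longrightarrow> U \<subseteq> units G \<Longrightarrow> (indicator U :: 'a \<Rightarrow> bit) \<in> carrier (C_c (unit_space G))"
  unfolding indicator_eq_const_on by (intro const_on_in_C_c) (simp add: compact_open_unit_space)

lemma exists_epi_H0:
  obtains h where "h \<in> epi (H0 G :: ('a \<Rightarrow> bit) set monoid) quot" "induced_by_tau G h"
proof -
  let ?C = "C_c (unit_space G) :: ('a \<Rightarrow> bit) monoid" and ?B = "boundaries G :: ('a \<Rightarrow> bit) set"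
  interpret C: comm_group ?C
    by (rule comm_group_C_c)
  \<comment> \<open>Representatives of one class in \<open>H0\<close> differ by a boundary, which
    \<open>psi\<close> sends to the unit.\<close>
  have fact: "psi f = psi g" if "f \<in> carrier ?C" "g \<in> carrier ?C" "?B #>\<^bsub>?C\<^esub> f = ?B #>\<^bsub>?C\<^esub> g" for f g
  proof -
    have "f \<in> ?B #>\<^bsub>?C\<^esub> g"
      using C.rcos_self [OF that(1) normal_imp_subgroup [OF boundaries_normal]] that(3) by simp
    then obtain b where b: "b \<in> carrier (C_c (gtop G))" "f = (\<lambda>x. delta1 G b x + g x)"
      by (auto simp: r_coset_def boundaries_def)
    then have "psi f = psi (delta1 G b) \<otimes>\<^bsub>quot\<^esub> psi g"
      using psi_add [OF delta1_closed that(2)] by simp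
    then show ?thesis
      using psi_delta1 [OF b(1)] hom_in_carrier [OF psi_hom that(2)] by simp
  qed
  obtain h where h: "h \<in> hom (?C Mod ?B) quot" "\<And>f. f \<in> carrier ?C \<Longrightarrow> h (?B #>\<^bsub>?C\<^esub> f) = psi f"
    using FactGroup_universal [OF psi_hom boundaries_normal fact] by blast
  have hind: "h (?B #>\<^bsub>?C\<^esub> indicator (src G ` F)) = cls (tau G F)" if "displacing F" for F
  proof -
    have "bisection G F"
      using that by (simp add: displacing_def)
    then show ?thesis
      using h(2) [OF indicator_in_C_c] compact_open_src [of F] phi_src [OF that] by (simp add: psi_indicator)
  qed
  interpret M: group "?C Mod ?B"
    by (rule normal.factorgroup_is_group [OF boundaries_normal])
  interpret h: group_hom "?C Mod ?B" quot h
    using h(1) by unfold_locales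
  \<comment> \<open>Surjectivity: the image is a subgroup and contains the classes of the generating
    involutions.\<close>
  have "cls g \<in> h ` carrier (?C Mod ?B)" if "g \<in> carrier (S_group G)" for g
    using that
  proof (induction rule: S_group_induct)
    case one
    then show ?case
      unfolding cls_units using subgroup.one_closed [OF h.img_is_subgroup] .
  next
    case (tau F)
    then have "bisection G F"
      by (simp add: displacing_def)
    then have "?B #>\<^bsub>?C\<^esub> indicator (src G ` F) \<in> carrier (?C Mod ?B)"
      unfolding carrier_FactGroup using indicator_in_C_c compact_open_src by (intro imageI) blast
    then show ?case
      using hind [OF tau] by (metis imageI)
  next
    case (mult x y)
    then show ?case
      unfolding cls_mult [OF mult(1,2)] by (intro subgroup.m_closed [OF h.img_is_subgroup])
  qed
  then have "h \<in> epi (?C Mod ?B) quot"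
    using h(1) hom_in_carrier [OF h(1)] by (auto simp: epi_def carrier_FactGroup [of "S_group G"])
  moreover have "induced_by_tau G h"
    using hind by (simp add: induced_by_tau_def H0_class_def displacing_def)
  ultimately show thesis
    using that by (simp add: H0_def)
qed

text \<open>The classes of indicators of sources of displacing bisections generate
  \<open>H0\<close>: every compact open set of units is a finite disjoint union of such
  sources.\<close>

lemma hom_H0_unique:
  assumes h: "h \<in> hom (H0 G :: ('a \<Rightarrow> bit) set monoid) quot" "induced_by_tau G h"
    and h': "h' \<in> hom (H0 G :: ('a \<Rightarrow> bit) set monoid) quot" "induced_by_tau G h'"
    and c: "c \<in> carrier (H0 G)"
  shows "h' c = h c"
proof -
  let ?C = "C_c (unit_space G) :: ('a \<Rightarrow> bit) monoid" and ?B = "boundaries G :: ('a \<Rightarrow> bit) set"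
  interpret C: comm_group ?C
    by (rule comm_group_C_c)
  interpret M: group "?C Mod ?B"
    by (rule normal.factorgroup_is_group [OF boundaries_normal])
  interpret h: group_hom "?C Mod ?B" quot h
    using h(1) by unfold_locales (simp add: H0_def)
  interpret h': group_hom "?C Mod ?B" quot h'
    using h'(1) by unfold_locales (simp add: H0_def)
  let ?c = "\<lambda>U. ?B #>\<^bsub>?C\<^esub> indicator U"
  have c_closed: "?c U \<in> carrier (?C Mod ?B)" if "compact_open (gtop G) U" "U \<subseteq> units G" for U
    using indicator_in_C_c that by (auto simp: carrier_FactGroup)
  have c_Un: "?c (V \<union> W) = ?c V \<otimes>\<^bsub>?C Mod ?B\<^esub> ?c W"
    if V: "compact_open (gtop G) V" "V \<subseteq> units G" and W: "compact_open (gtop G) W" "W \<subseteq> units G" and "V \<inter> W = {}" for V W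
  proof -
    have "indicator (V \<union> W) = (indicator V \<otimes>\<^bsub>?C\<^esub> indicator W :: 'a \<Rightarrow> bit)"
      using const_on_Un [OF \<open>V \<inter> W = {}\<close>, of "1::bit"] unfolding indicator_eq_const_on by simp
    then show ?thesis
      using hom_mult [OF normal.r_coset_hom_Mod [OF boundaries_normal] indicator_in_C_c [OF V] indicator_in_C_c [OF W]]
      by simp
  qed
  have eq: "h' (?c U) = h (?c U)" if U: "compact_open (gtop G) U" "U \<subseteq> units G" for U
    using U(1)
  proof (induction rule: compact_open_induct)
    case empty
    have "indicator {} = (\<one>\<^bsub>?C\<^esub> :: 'a \<Rightarrow> bit)"
      by (simp add: fun_eq_iff)
    then have "?c {} = \<one>\<^bsub>?C Mod ?B\<^esub>"
      using group_hom.hom_one [of ?C "?C Mod ?B"] normal.r_coset_hom_Mod [OF boundaries_normal]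
      by (metis C.is_group M.is_group group_hom.intro group_hom_axioms.intro)
    then show ?case
      by (simp only: h.hom_one h'.hom_one)
  next
    case (union V W)
    then have "V \<subseteq> units G" "W \<subseteq> units G"
      using U(2) by auto
    then show ?case
      using union c_closed by (simp add: c_Un)
  next
    case (basis x)
    then have x: "x \<in> units G"
      using U by blast
    obtain K where K: "displacing K" "src G x \<in> src G ` K"
      using exists_displacing [OF bisection_units x] by metis
    then have bK: "bisection G K"
      by (simp add: displacing_def)
    note S = compact_open_src [OF bK]
    \<comment> \<open>Every compact open \<open>V\<close> inside s(K) is the source of the
      displacing bisection \<open>restr K V\<close>, and there both homomorphisms are
      prescribed.\<close>
    have "h' (?c V) = h (?c V)" if V: "compact_open (gtop G) V" "V \<subseteq> U \<inter> src G ` K" for V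
    proof -
      have "displacing (restr K V)"
        using V S displacing_restr [OF K(1) V(1)] by blast
      then have "h' (?c (src G ` restr K V)) = h (?c (src G ` restr K V))"
        using h(2) h'(2) by (simp add: induced_by_tau_def H0_class_def displacing_def)
      moreover have "src G ` restr K V = V"
        using V by (intro src_image_restr) blast
      ultimately show ?thesis
        by simp
    qed
    moreover have "compact_open (gtop G) (U \<inter> src G ` K)"
      using compact_open_Int [OF compact_open_units] U S by blast
    ultimately show ?case
      using basis K(2) x by (intro exI [of _ "U \<inter> src G ` K"]) (auto simp: src_unit)
  qed
  obtain f where f: "f \<in> carrier ?C" "c = ?B #>\<^bsub>?C\<^esub> f"
    using c by (auto simp: H0_def carrier_FactGroup)
  then show ?thesis
    using eq [of "{x. f x \<noteq> 0}"] C_c_bit_support [OF f(1)] bit_eq_indicator [of f] by simp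
qed

end

theorem theorem7p2:
  fixes G :: "'g top_groupoid"
  assumes "etale_groupoid G"
    and "unit_space G homeomorphic_space cantor_space"
    and "\<forall>x\<in>units G. infinite (groupoid_orbit G x) \<or> 3 \<le> card (groupoid_orbit G x)"
  shows "\<exists>h \<in> epi (H0 G :: ('g \<Rightarrow> bit) set monoid) (S_group G Mod carrier (A_group G)).
           induced_by_tau G h \<and>
           (\<forall>h' \<in> hom (H0 G) (S_group G Mod carrier (A_group G)).
              induced_by_tau G h' \<longrightarrow> (\<forall>c \<in> carrier (H0 G). h' c = h c))"
proof -
  have "Hausdorff_space cantor_space" "compact_space cantor_space"
    by (simp_all add: cantor_space_def Hausdorff_space_product_topology compact_space_product_topology
        compact_space_discrete_topology)
  then interpret large_orbit_groupoid G
    using assms homeomorphic_Hausdorff_space homeomorphic_compact_space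
    by (intro large_orbit_groupoid.intro compact_etale_groupoid.intro compact_etale_groupoid_axioms.intro
        large_orbit_groupoid_axioms.intro) blast+
  obtain h where h: "h \<in> epi (H0 G :: ('g \<Rightarrow> bit) set monoid) quot" "induced_by_tau G h"
    by (rule exists_epi_H0)
  then have "h \<in> hom (H0 G :: ('g \<Rightarrow> bit) set monoid) quot"
    by (simp add: epi_def)
  then show ?thesis
    using h hom_H0_unique by blast
qed

end
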